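(* For any $N\in\mathbb{N}$, $M\in\mathbb{N}_0$, $r\in\frac N2+\mathbb{Z}$, the Fourier coefficients of $\phi_{2M,N+2M}(z;\tau)$ in the range $0<\operatorname{Im}(z)<\operatorname{Im}(\tau)$ are $$\chi(2M,N+2M,r;\tau)=(-1)^{1+\delta_e}q^{-\frac{r^2}{2N}}\sum_{j=0}^{\frac{N-1-\delta_e}2+M}\frac{D_{2j+\delta_e+1}(\tau)}{(2j+\delta_e)!}N^{j+\delta_e}2^{j}\,\mathcal D_q^{j}\left(\Theta_{\frac12+\delta_e}(N,\rho(r);\tau)\right),$$ where $D_k(\tau)$ denotes the Laurent coefficients of $\phi_{2M,N+2M}(z;\tau)$ at $z=0$.
   Context: Notation: $\tau\in\mathbb{H}$, $z\in\mathbb{C}$, $q=e^{2\pi i\tau}$, $\zeta=e^{2\pi iz}$, $q^a=e^{2\pi ia\tau}$, $\zeta^a=e^{2\pi iaz}$; $(a)_\infty=\prod_{j\ge0}(1-aq^j)$; $\mathcal D_q=q\frac{\partial}{\partial q}=\frac1{2\pi i}\frac{\partial}{\partial\tau}$. Let $\vartheta(z;\tau)=-i\zeta^{-1/2}q^{1/8}(q)_\infty(\zeta)_\infty(\zeta^{-1}q)_\infty$ and $\phi_{M,N}(z;\tau)=\vartheta(z+\frac12;\tau)^M/\vartheta(z;\tau)^N$. In the range $0<\operatorname{Im}(z)<\operatorname{Im}(\tau)$ write $\phi_{M,N}(z;\tau)=\sum_{r\in\frac{M-N}2+\mathbb{Z}}\chi(M,N,r;\tau)\zeta^r$. The Laurent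 coefficients at $z=0$ (depending on $M,N$) are defined by $\phi_{M,N}(z;\tau)=\frac{D_N(\tau)}{(2\pi iz)^N}+\frac{D_{N-2}(\tau)}{(2\pi iz)^{N-2}}+\dots+O(1)$; for $\phi_{2M,N+2M}$ the leading coefficient is thus $D_{N+2M}$. Set $\delta_e=0$ if $N$ is odd, $\delta_e=1$ if $N$ is even. Define $$\Theta_{\frac12+\delta_e}(N,r;\tau)=\sum_{n\ge0}(-1)^{Nn}\left(n+\tfrac rN\right)^{\delta_e}q^{\frac N2\left(n+\frac rN\right)^2},\qquad \rho(r)=\begin{cases}r&\text{if }r\ge\frac N2,\\ N-r&\text{if }r<\frac N2.\end{cases}$$ *)

theory Defs
  imports "HOL-Complex_Analysis.Complex_Analysis"
begin

text \<open>
  Real powers of \<open>q\<close> and \<open>\<zeta>\<close> are not powers of complex numbers (no branch is chosen):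
  \<open>q\<^sup>a = cexp2pi (a * \<tau>)\<close> and \<open>\<zeta>\<^sup>a = cexp2pi (a * z)\<close>.
\<close>
definition cexp2pi :: "complex \<Rightarrow> complex" where
  "cexp2pi x = exp (2 * of_real pi * \<i> * x)"

definition qpoch_inf :: "complex \<Rightarrow> complex \<Rightarrow> complex" where
  "qpoch_inf a \<tau> = (\<Prod>j. 1 - a * cexp2pi \<tau> ^ j)"

definition jtheta :: "complex \<Rightarrow> complex \<Rightarrow> complex" where
  "jtheta z \<tau> = - \<i> * cexp2pi (- (z / 2)) * cexp2pi (\<tau> / 8) *
     qpoch_inf (cexp2pi \<tau>) \<tau> * qpoch_inf (cexp2pi z) \<tau> *
     qpoch_inf (cexp2pi (- z) * cexp2pi \<tau>) \<tau>"

definition jphi :: "nat \<Rightarrow> nat \<Rightarrow> complex \<Rightarrow> complex \<Rightarrow> complex" where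
  "jphi M N z \<tau> = jtheta (z + 1/2) \<tau> ^ M / jtheta z \<tau> ^ N"

definition fourier_index :: "nat \<Rightarrow> nat \<Rightarrow> real set" where
  "fourier_index M N = {(real M - real N) / 2 + of_int k | k. True}"

definition is_fourier_coeffs :: "nat \<Rightarrow> nat \<Rightarrow> complex \<Rightarrow> (real \<Rightarrow> complex) \<Rightarrow> bool" where
  "is_fourier_coeffs M N \<tau> c \<longleftrightarrow>
     (\<forall>z. 0 < Im z \<and> Im z < Im \<tau> \<longrightarrow>
        ((\<lambda>r. c r * cexp2pi (of_real r * z)) has_sum jphi M N z \<tau>) (fourier_index M N))"

text \<open>
  The coefficients are determined by the expansion only at indices in \<^term>\<open>fourier_index M N\<close>;
  the value of \<open>jchi M N r \<tau>\<close> is meaningless for other \<open>r\<close>.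
\<close>
definition jchi :: "nat \<Rightarrow> nat \<Rightarrow> real \<Rightarrow> complex \<Rightarrow> complex" where
  "jchi M N r \<tau> = (SOME c. is_fourier_coeffs M N \<tau> c) r"

text \<open>
  Coefficient of \<open>(2 \<pi> \<i> z)\<^bsup>-k\<^esup>\<close>, rather than of \<open>z\<^bsup>-k\<^esup>\<close>, in the Laurent expansion at \<open>z = 0\<close>.
\<close>
definition jlaurent :: "nat \<Rightarrow> nat \<Rightarrow> nat \<Rightarrow> complex \<Rightarrow> complex" where
  "jlaurent M N k \<tau> =
     (2 * of_real pi * \<i>) ^ k * fls_nth (laurent_expansion (\<lambda>z. jphi M N z \<tau>) 0) (- int k)"

definition delta_e :: "nat \<Rightarrow> nat" where
  "delta_e N = (if even N then 1 else 0)"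

text \<open>The partial theta function \<open>\<Theta>\<^bsub>1/2 + \<delta>\<^esub>\<close> with \<open>\<delta> = delta_e N\<close>.\<close>
definition partial_theta :: "nat \<Rightarrow> real \<Rightarrow> complex \<Rightarrow> complex" where
  "partial_theta N r \<tau> =
     (\<Sum>n. (-1) ^ (N * n) * of_real ((real n + r / real N) ^ delta_e N) *
        cexp2pi (of_real (real N / 2 * (real n + r / real N)\<^sup>2) * \<tau>))"

definition rho :: "nat \<Rightarrow> real \<Rightarrow> real" where
  "rho N r = (if r \<ge> real N / 2 then r else real N - r)"

definition Dq :: "(complex \<Rightarrow> complex) \<Rightarrow> complex \<Rightarrow> complex" where
  "Dq f \<tau> = deriv f \<tau> / (2 * of_real pi * \<i>)"

end

theory Submission
  imports Defs "HOL-Real_Asymp.Real_Asymp"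
begin

text \<open>
  Write \<open>\<phi>\<close> for \<open>\<phi>\<^bsub>2M,N+2M\<^esub>\<close> and \<open>c r\<close> for its Fourier coefficients in the strip \<open>0 < Im z < Im \<tau>\<close>.
  The form \<open>\<phi>\<close> is not holomorphic on the line \<open>Im z = 0\<close>, so its Fourier coefficients on the two
  sides of that line differ. The difference is a residue, and this is where the Laurent coefficients
  \<open>D\<^sub>k\<close> enter. Integrating \<open>\<phi>(z) \<zeta>\<^bsup>-r\<^esup>\<close> around a rectangle of width \<open>1\<close> centred at \<open>0\<close>, the vertical
  sides cancel by periodicity, and since \<open>\<phi>(-z) = (-1)\<^sup>N \<phi>(z)\<close> the lower side gives \<open>(-1)\<^sup>N c(-r)\<close>. Hence
  (\<open>fourier_coeff_residue\<close>, \<open>residue_jphi_exp\<close>)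
  
    \<open>(-1)\<^sup>N c(-r) - c(r) = P(r)\<close>, where \<open>P(r) = (\<Sum>k. D\<^sub>k (-r)\<^bsup>k-1\<^esup> / (k-1)!)\<close>.
  
  The elliptic transformation, in the form \<open>\<phi>(\<tau> - z) = q\<^bsup>N/2\<^esup> \<zeta>\<^bsup>-N\<^esup> \<phi>(z)\<close>, maps the strip to itself, so that
  comparing coefficients gives \<open>c(r) = q\<^bsup>N/2-r\<^esup> c(N - r)\<close> (\<open>fourier_coeff_reflect\<close>). Together,
  
    \<open>c(r) = (-1)\<^sup>N q\<^bsup>N/2+r\<^esup> c(r + N) - P(r)\<close>.
  
  Iterating this, the powers of \<open>q\<close> accumulate to \<open>q\<^bsup>nr + Nn\<^sup>2/2\<^esup> = q\<^bsup>-r\<^sup>2/2N\<^esup> q\<^bsup>N/2 (n + r/N)\<^sup>2\<^esup>\<close>, which decays fast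
  enough to beat the growth of \<open>c(r + nN)\<close>, so \<open>c(r)\<close> is minus the convergent series of the terms
  \<open>(-1)\<^bsup>Nn\<^esup> q\<^bsup>nr + Nn\<^sup>2/2\<^esup> P(r + nN)\<close> (\<open>fourier_coeff_sums\<close>). By parity only \<open>k = 2j + \<delta> + 1\<close> contributes to
  \<open>P\<close>, and a factor \<open>(n + r/N)\<^bsup>2j\<^esup>\<close> in front of \<open>q\<^bsup>N/2 (n + r/N)\<^sup>2\<^esup>\<close> is, up to \<open>(N/2)\<^sup>j\<close>, the effect of the
  \<open>j\<close>-th power of \<open>q d/dq\<close> (\<open>Dq_iterate\<close>). This is the asserted formula with \<open>r\<close> in place of \<open>\<rho>(r)\<close>, for
  every \<open>r\<close> (\<open>fourier_coeff_formula\<close>); the reflection \<open>r \<mapsto> N - r\<close> turns it into the one with \<open>\<rho>(r)\<close>.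
  
  That the Fourier expansion exists at all is read off from the product formula: up to a monomial in
  \<open>\<zeta>\<^bsup>1/2\<^esup>\<close>, \<open>\<phi>\<close> is \<open>A(\<zeta>) A(q/\<zeta>)\<close> with \<open>A\<close> holomorphic in the unit disc, and two power series multiply
  to a Laurent series (\<open>is_fourier_coeffs_exists\<close>).
\<close>

section \<open>Real powers of \<open>q\<close> and \<open>\<zeta>\<close>\<close>

lemma cexp2pi_add: "cexp2pi (x + y) = cexp2pi x * cexp2pi y"
  by (simp add: cexp2pi_def exp_add ring_distribs)

lemma cexp2pi_minus: "cexp2pi (- x) = inverse (cexp2pi x)"
  by (simp add: cexp2pi_def exp_minus)

lemma cexp2pi_diff: "cexp2pi (x - y) = cexp2pi x / cexp2pi y"
  by (simp add: cexp2pi_def exp_diff ring_distribs)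

lemma cexp2pi_nonzero [simp]: "cexp2pi x \<noteq> 0"
  by (simp add: cexp2pi_def)

lemma cexp2pi_0 [simp]: "cexp2pi 0 = 1"
  by (simp add: cexp2pi_def)

lemma cexp2pi_power: "cexp2pi x ^ n = cexp2pi (of_nat n * x)"
  by (simp add: cexp2pi_def exp_of_nat_mult [symmetric] mult_ac)

lemma norm_cexp2pi: "norm (cexp2pi x) = exp (- 2 * pi * Im x)"
  by (simp add: cexp2pi_def)

lemma norm_cexp2pi_less_1_iff: "norm (cexp2pi x) < 1 \<longleftrightarrow> Im x > 0"
  by (simp add: norm_cexp2pi zero_less_mult_iff)

lemma cexp2pi_of_int [simp]: "cexp2pi (of_int k) = 1"
proof -
  have "exp (2 * of_real pi * \<i> * complex_of_int k) = 1"
    by (subst exp_eq_1) (auto intro!: exI[of _ k])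
  thus ?thesis by (simp add: cexp2pi_def)
qed

lemma cexp2pi_1 [simp]: "cexp2pi 1 = 1"
  using cexp2pi_of_int[of 1] by simp

lemma cexp2pi_half [simp]: "cexp2pi (1 / 2) = - 1"
  by (simp add: cexp2pi_def)

lemma cexp2pi_eq_1_iff: "cexp2pi x = 1 \<longleftrightarrow> (\<exists>k. x = of_int k)"
proof
  assume "cexp2pi x = 1"
  then obtain n where n: "2 * pi * Im x = 0" "2 * pi * Re x = real_of_int (2 * n) * pi"
    unfolding cexp2pi_def exp_eq_1 by auto
  have "x = of_int n" using n by (auto simp: complex_eq_iff)
  thus "\<exists>k. x = of_int k" ..
qed auto

lemma holomorphic_on_cexp2pi [holomorphic_intros]:
  "f holomorphic_on A \<Longrightarrow> (\<lambda>x. cexp2pi (f x)) holomorphic_on A"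
  unfolding cexp2pi_def by (intro holomorphic_intros)

lemma continuous_on_cexp2pi [continuous_intros]:
  "continuous_on A f \<Longrightarrow> continuous_on A (\<lambda>x. cexp2pi (f x))"
  unfolding cexp2pi_def by (intro continuous_intros)

lemma has_field_derivative_cexp2pi:
  "((\<lambda>x. cexp2pi (c * x)) has_field_derivative 2 * of_real pi * \<i> * c * cexp2pi (c * x)) (at x)"
  unfolding cexp2pi_def by (auto intro!: derivative_eq_intros)

section \<open>The infinite product as an entire function\<close>

lemma qpoch_abs_convergent:
  assumes "Im \<tau> > 0"
  shows   "abs_convergent_prod (\<lambda>j. 1 - a * cexp2pi \<tau> ^ j)"
proof -
  have "summable (\<lambda>j. norm a * norm (cexp2pi \<tau>) ^ j)"
    using assms by (intro summable_mult summable_geometric) (auto simp: norm_cexp2pi_less_1_iff)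
  thus ?thesis
    by (simp add: abs_convergent_prod_conv_summable norm_mult norm_power)
qed

lemma qpoch_convergent:
  assumes "Im \<tau> > 0"
  shows   "convergent_prod (\<lambda>j. 1 - a * cexp2pi \<tau> ^ j)"
  using abs_convergent_prod_imp_convergent_prod[OF qpoch_abs_convergent[OF assms]] .

lemma qpoch_inf_nonzero:
  assumes "Im \<tau> > 0" "norm a < 1"
  shows   "qpoch_inf a \<tau> \<noteq> 0"
  unfolding qpoch_inf_def
proof (rule prodinf_nonzero[OF qpoch_convergent[OF assms(1)]])
  fix j
  have q: "norm (cexp2pi \<tau>) ^ j \<le> 1"
    using assms(1) by (intro power_le_one) (auto simp: norm_cexp2pi_less_1_iff less_imp_le)
  have "norm (a * cexp2pi \<tau> ^ j) \<le> norm a * 1"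
    unfolding norm_mult norm_power by (intro mult_left_mono q) auto
  also have "\<dots> < 1" using assms by simp
  finally show "1 - a * cexp2pi \<tau> ^ j \<noteq> 0" by auto
qed

lemma qpoch_inf_shift:
  assumes "Im \<tau> > 0"
  shows   "qpoch_inf a \<tau> = (1 - a) * qpoch_inf (a * cexp2pi \<tau>) \<tau>"
proof (rule LIMSEQ_unique)
  show "(\<lambda>n. \<Prod>j\<le>Suc n. 1 - a * cexp2pi \<tau> ^ j) \<longlonglongrightarrow> qpoch_inf a \<tau>"
    unfolding qpoch_inf_def
    by (rule LIMSEQ_Suc[OF convergent_prod_LIMSEQ[OF qpoch_convergent[OF assms]]])
  have "(\<lambda>n. (1 - a) * (\<Prod>j\<le>n. 1 - a * cexp2pi \<tau> * cexp2pi \<tau> ^ j))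
          \<longlonglongrightarrow> (1 - a) * qpoch_inf (a * cexp2pi \<tau>) \<tau>"
    unfolding qpoch_inf_def
    by (intro tendsto_intros convergent_prod_LIMSEQ qpoch_convergent assms)
  thus "(\<lambda>n. \<Prod>j\<le>Suc n. 1 - a * cexp2pi \<tau> ^ j)
          \<longlonglongrightarrow> (1 - a) * qpoch_inf (a * cexp2pi \<tau>) \<tau>"
    by (subst prod.atMost_Suc_shift) (simp add: mult_ac)
qed

lemma holomorphic_qpoch_inf:
  assumes "Im \<tau> > 0"
  shows   "(\<lambda>a. qpoch_inf a \<tau>) holomorphic_on A"
proof -
  have "(\<lambda>a. qpoch_inf a \<tau>) holomorphic_on UNIV"
  proof (rule holomorphic_uniform_sequence)
    show "(\<lambda>a. \<Prod>j<n. 1 - a * cexp2pi \<tau> ^ j) holomorphic_on UNIV" for n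
      by (intro holomorphic_intros)
  next
    fix x :: complex
    define B where "B = cball x 1"
    have bnd: "norm a \<le> norm x + 1" if "a \<in> B" for a
      using that norm_triangle_sub[of a x] by (auto simp: B_def dist_norm norm_minus_commute)
    have summ: "summable (\<lambda>j. (norm x + 1) * norm (cexp2pi \<tau>) ^ j)"
      using assms by (intro summable_mult summable_geometric) (auto simp: norm_cexp2pi_less_1_iff)
    have "uniformly_convergent_on B (\<lambda>N a. \<Sum>n<N. norm (1 - a * cexp2pi \<tau> ^ n - 1))"
      by (rule Weierstrass_m_test'[OF _ summ])
        (auto simp: norm_mult norm_power intro!: mult_right_mono bnd)
    hence "uniformly_convergent_on B (\<lambda>N a. \<Prod>n<N. 1 - a * cexp2pi \<tau> ^ n)"
      by (intro uniformly_convergent_on_prod') (auto simp: B_def intro!: continuous_intros)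
    then obtain g where g: "uniform_limit B (\<lambda>N a. \<Prod>n<N. 1 - a * cexp2pi \<tau> ^ n) g sequentially"
      unfolding uniformly_convergent_on_def by blast
    have "g a = qpoch_inf a \<tau>" if "a \<in> B" for a
    proof (rule LIMSEQ_unique)
      show "(\<lambda>N. \<Prod>n<N. 1 - a * cexp2pi \<tau> ^ n) \<longlonglongrightarrow> g a"
        using tendsto_uniform_limitI[OF g that] .
      show "(\<lambda>N. \<Prod>n<N. 1 - a * cexp2pi \<tau> ^ n) \<longlonglongrightarrow> qpoch_inf a \<tau>"
        using convergent_prod_LIMSEQ[OF qpoch_convergent[OF assms, of a]]
        by (simp add: qpoch_inf_def LIMSEQ_lessThan_iff_atMost)
    qed
    hence "uniform_limit B (\<lambda>N a. \<Prod>n<N. 1 - a * cexp2pi \<tau> ^ n) (\<lambda>a. qpoch_inf a \<tau>) sequentially"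
      using g by (simp cong: uniform_limit_cong')
    thus "\<exists>d>0. cball x d \<subseteq> UNIV \<and>
            uniform_limit (cball x d) (\<lambda>n a. \<Prod>j<n. 1 - a * cexp2pi \<tau> ^ j) (\<lambda>a. qpoch_inf a \<tau>) sequentially"
      by (auto simp: B_def intro!: exI[of _ 1])
  qed auto
  thus ?thesis by (rule holomorphic_on_subset) auto
qed

section \<open>The theta function and the Jacobi form\<close>

lemma cexp2pi_add_half: "cexp2pi (x + 1/2) = - cexp2pi x"
  by (simp add: cexp2pi_add)

lemma jtheta_plus_1: "jtheta (z + 1) \<tau> = - jtheta z \<tau>"
proof -
  have "cexp2pi (- ((z + 1) / 2)) = - cexp2pi (- (z / 2))"
    using cexp2pi_diff[of "-(z/2)" "1/2"] by (simp add: add_divide_distrib)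
  moreover have "cexp2pi (z + 1) = cexp2pi z" "cexp2pi (- (z + 1)) = cexp2pi (- z)"
    by (simp_all add: cexp2pi_add cexp2pi_minus del: minus_add_distrib)
  ultimately show ?thesis by (simp add: jtheta_def del: minus_add_distrib)
qed

text \<open>
  Both products change by one factor when \<open>z\<close> changes sign, and what is left of these two factors
  after combining them with \<open>\<zeta>\<^bsup>-1/2\<^esup>\<close> is the sign.
\<close>
lemma jtheta_minus:
  assumes "Im \<tau> > 0"
  shows   "jtheta (-z) \<tau> = - jtheta z \<tau>"
proof -
  define q \<zeta> s where "q = cexp2pi \<tau>" and "\<zeta> = cexp2pi z" and "s = cexp2pi (z / 2)"
  have s: "\<zeta> = s\<^sup>2" "s \<noteq> 0" by (simp_all add: s_def \<zeta>_def cexp2pi_power)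
  have 1: "qpoch_inf \<zeta> \<tau> = (1 - \<zeta>) * qpoch_inf (\<zeta> * q) \<tau>"
    using qpoch_inf_shift[OF assms, of \<zeta>] by (simp add: q_def)
  have 2: "qpoch_inf (inverse \<zeta>) \<tau> = (1 - inverse \<zeta>) * qpoch_inf (inverse \<zeta> * q) \<tau>"
    using qpoch_inf_shift[OF assms, of "inverse \<zeta>"] by (simp add: q_def)
  have 3: "s * (1 - inverse \<zeta>) = - (inverse s * (1 - \<zeta>))"
    using s by (simp add: field_simps power2_eq_square)
  define X where "X = \<i> * cexp2pi (\<tau> / 8) * qpoch_inf q \<tau> * qpoch_inf (\<zeta> * q) \<tau> *
    qpoch_inf (inverse \<zeta> * q) \<tau>"
  have "jtheta (-z) \<tau> = - (s * (1 - inverse \<zeta>)) * X"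
    unfolding jtheta_def by (simp add: cexp2pi_minus 2 X_def flip: q_def \<zeta>_def s_def)
  also have "\<dots> = inverse s * (1 - \<zeta>) * X" using 3 by simp
  also have "\<dots> = - jtheta z \<tau>"
    unfolding jtheta_def by (simp add: cexp2pi_minus 1 X_def flip: q_def \<zeta>_def s_def)
  finally show ?thesis .
qed

text \<open>
  Reflecting at \<open>\<tau>/2\<close> rather than translating by \<open>\<tau>\<close> merely interchanges the two \<open>z\<close>-dependent products,
  and it preserves the strip in which the Fourier expansion lives. This is the form in which the
  elliptic transformation law enters.
\<close>
lemma jtheta_reflect:
  "jtheta (\<tau> - z) \<tau> = cexp2pi (z - \<tau> / 2) * jtheta z \<tau>"
proof -
  have "cexp2pi (-((\<tau> - z) / 2)) = cexp2pi (z - \<tau> / 2) * cexp2pi (-(z/2))"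
    unfolding cexp2pi_add[symmetric] by (rule arg_cong[of _ _ cexp2pi]) (simp add: field_simps)
  moreover have "cexp2pi (\<tau> - z) = cexp2pi (-z) * cexp2pi \<tau>"
    "cexp2pi (- (\<tau> - z)) * cexp2pi \<tau> = cexp2pi z"
    by (simp_all flip: cexp2pi_add)
  ultimately show ?thesis unfolding jtheta_def by (simp add: mult_ac)
qed

lemma jtheta_half_minus:
  assumes "Im \<tau> > 0"
  shows   "jtheta (- z + 1/2) \<tau> = jtheta (z + 1/2) \<tau>"
proof -
  have "- (z - 1/2) = - z + 1/2" "z - 1/2 + 1 = z + 1/2" by simp_all
  thus ?thesis
    using jtheta_minus[OF assms, of "z - 1/2"] jtheta_plus_1[of "z - 1/2" \<tau>] by metis
qed

lemma jtheta_half_reflect: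
  assumes "Im \<tau> > 0"
  shows   "jtheta (\<tau> - z + 1/2) \<tau> = cexp2pi (z - \<tau> / 2) * jtheta (z + 1/2) \<tau>"
proof -
  have "jtheta (\<tau> - (z - 1/2)) \<tau> = cexp2pi (z - 1/2 - \<tau> / 2) * jtheta (z - 1/2) \<tau>"
    by (rule jtheta_reflect)
  moreover have "\<tau> - (z - 1/2) = \<tau> - z + 1/2" by simp
  moreover have "jtheta (z - 1/2) \<tau> = - jtheta (z + 1/2) \<tau>"
  proof -
    have "z - 1/2 + 1 = z + 1/2" by simp
    thus ?thesis using jtheta_plus_1[of "z - 1/2" \<tau>] by (metis minus_minus)
  qed
  moreover have "cexp2pi (z - 1/2 - \<tau> / 2) = - cexp2pi (z - \<tau> / 2)"
    using cexp2pi_add_half[of "z - 1/2 - \<tau> / 2"] by simp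
  ultimately show ?thesis by simp
qed

lemma jphi_plus_1: "jphi (2 * M) (N + 2 * M) (z + 1) \<tau> = (-1) ^ N * jphi (2 * M) (N + 2 * M) z \<tau>"
proof -
  have "jtheta (z + 1 + 1/2) \<tau> = - jtheta (z + 1/2) \<tau>"
    using jtheta_plus_1[of "z + 1/2" \<tau>] by (simp add: add_ac)
  thus ?thesis
    by (simp add: jphi_def jtheta_plus_1 power_minus[of "jtheta z \<tau>"] power_add power_mult
          flip: minus_one_power_iff) (auto simp: uminus_power_if)
qed

lemma jphi_minus:
  assumes "Im \<tau> > 0"
  shows   "jphi (2 * M) (N + 2 * M) (- z) \<tau> = (-1) ^ N * jphi (2 * M) (N + 2 * M) z \<tau>"
  using jtheta_half_minus[OF assms, of z] jtheta_minus[OF assms, of z]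
  by (simp add: jphi_def uminus_power_if)

lemma jphi_reflect:
  assumes "Im \<tau> > 0"
  shows   "jphi (2 * M) (N + 2 * M) (\<tau> - z) \<tau> =
             cexp2pi (of_nat N * (\<tau> / 2 - z)) * jphi (2 * M) (N + 2 * M) z \<tau>"
proof -
  define e where "e = cexp2pi (z - \<tau> / 2)"
  have "cexp2pi (of_nat N * (\<tau> / 2 - z)) = inverse (e ^ N)"
    unfolding e_def cexp2pi_power cexp2pi_minus[symmetric] by (simp add: algebra_simps)
  moreover have "e \<noteq> 0" by (simp add: e_def)
  moreover have "jtheta (\<tau> - z + 1/2) \<tau> = e * jtheta (z + 1/2) \<tau>"
    "jtheta (\<tau> - z) \<tau> = e * jtheta z \<tau>"
    unfolding e_def by (rule jtheta_half_reflect[OF assms] jtheta_reflect)+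
  ultimately show ?thesis
    unfolding jphi_def by (simp only:) (simp add: power_mult_distrib power_add divide_simps)
qed

text \<open>
  The theta function without the one factor \<open>1 - \<zeta>\<close> of its product that vanishes in the
  strip \<open>\<bar>Im z\<bar> < Im \<tau>\<close>; all poles of \<open>\<phi>\<close> in that strip come from that factor.
\<close>
definition jtheta_cofactor :: "complex \<Rightarrow> complex \<Rightarrow> complex" where
  "jtheta_cofactor \<tau> z = - \<i> * cexp2pi (- (z / 2)) * cexp2pi (\<tau> / 8) *
     qpoch_inf (cexp2pi \<tau>) \<tau> * qpoch_inf (cexp2pi z * cexp2pi \<tau>) \<tau> *
     qpoch_inf (cexp2pi (- z) * cexp2pi \<tau>) \<tau>"

lemma jtheta_eq_cofactor: "Im \<tau> > 0 \<Longrightarrow> jtheta z \<tau> = (1 - cexp2pi z) * jtheta_cofactor \<tau> z"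
  using qpoch_inf_shift[of \<tau> "cexp2pi z"] by (simp add: jtheta_def jtheta_cofactor_def mult_ac)

lemma jtheta_cofactor_nonzero:
  assumes "\<bar>Im z\<bar> < Im \<tau>"
  shows   "jtheta_cofactor \<tau> z \<noteq> 0"
proof -
  have "Im \<tau> > 0" using assms by linarith
  moreover have "norm (cexp2pi z * cexp2pi \<tau>) < 1" "norm (cexp2pi (-z) * cexp2pi \<tau>) < 1"
    "norm (cexp2pi \<tau>) < 1"
    unfolding cexp2pi_add [symmetric] norm_cexp2pi_less_1_iff using assms by auto
  ultimately show ?thesis
    using qpoch_inf_nonzero[of \<tau>] by (simp add: jtheta_cofactor_def)
qed

lemma holomorphic_on_qpoch_inf [holomorphic_intros]:
  assumes "Im \<tau> > 0" "f holomorphic_on A"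
  shows   "(\<lambda>z. qpoch_inf (f z) \<tau>) holomorphic_on A"
  using holomorphic_on_compose[OF assms(2) holomorphic_qpoch_inf[OF assms(1)]] by (simp add: o_def)

lemma holomorphic_jtheta_cofactor: "Im \<tau> > 0 \<Longrightarrow> jtheta_cofactor \<tau> holomorphic_on A"
  unfolding jtheta_cofactor_def by (intro holomorphic_intros) auto

lemma holomorphic_jtheta_half: "Im \<tau> > 0 \<Longrightarrow> (\<lambda>z. jtheta (z + 1/2) \<tau>) holomorphic_on A"
  unfolding jtheta_def by (intro holomorphic_intros) auto

definition jphi_numerator :: "nat \<Rightarrow> nat \<Rightarrow> complex \<Rightarrow> complex \<Rightarrow> complex" where
  "jphi_numerator M N \<tau> z = jtheta (z + 1/2) \<tau> ^ M / jtheta_cofactor \<tau> z ^ N"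

lemma jphi_eq_numerator: "Im \<tau> > 0 \<Longrightarrow> jphi M N z \<tau> = jphi_numerator M N \<tau> z / (1 - cexp2pi z) ^ N"
  by (simp add: jphi_def jphi_numerator_def jtheta_eq_cofactor power_mult_distrib mult.commute)

lemma holomorphic_jphi_numerator:
  "Im \<tau> > 0 \<Longrightarrow> jphi_numerator M N \<tau> holomorphic_on {z. \<bar>Im z\<bar> < Im \<tau>}"
  unfolding jphi_numerator_def
  by (intro holomorphic_intros holomorphic_jtheta_cofactor holomorphic_jtheta_half) (auto simp: jtheta_cofactor_nonzero)

lemma holomorphic_jphi:
  assumes "Im \<tau> > 0" "A \<subseteq> {z. \<bar>Im z\<bar> < Im \<tau>}" "A \<inter> \<int> = {}"
  shows   "(\<lambda>z. jphi M N z \<tau>) holomorphic_on A"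
proof -
  have "(\<lambda>z. jphi_numerator M N \<tau> z / (1 - cexp2pi z) ^ N) holomorphic_on A"
    by (intro holomorphic_intros holomorphic_on_subset[OF holomorphic_jphi_numerator assms(2)] assms(1))
      (use assms(3) in \<open>auto simp: cexp2pi_eq_1_iff eq_commute[of 1]\<close>)
  thus ?thesis using jphi_eq_numerator[OF assms(1)] by simp
qed

section \<open>Existence and uniqueness of the Fourier expansion\<close>

text \<open>
  Collecting the terms of an unconditionally convergent double series that belong to the same
  exponent, without naming the fibres explicitly.
\<close>
lemma has_sum_fibres:
  fixes f :: "'a \<Rightarrow> complex"
  assumes "(f has_sum S) A" "h ` A \<subseteq> B"
    and "\<And>b. b \<in> B \<Longrightarrow> (f has_sum g b) {a \<in> A. h a = b}"
  shows   "(g has_sum S) B"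
proof (rule has_sum_SigmaD)
  show "((\<lambda>(b, a). f a) has_sum S) (Sigma B (\<lambda>b. {a \<in> A. h a = b}))"
    using assms(1)
    by (rule has_sum_reindex_bij_witness[of _ "\<lambda>a. (h a, a)" snd, THEN iffD2, rotated -1])
      (use assms(2) in auto)
qed (use assms(3) in auto)

lemma has_sum_times:
  fixes f :: "'a \<Rightarrow> complex" and g :: "'b \<Rightarrow> complex"
  assumes "(f has_sum S) A" "(g has_sum T) B"
  shows   "((\<lambda>(x, y). f x * g y) has_sum S * T) (A \<times> B)"
proof (rule has_sum_SigmaI)
  show "((\<lambda>y. case (x, y) of (x, y) \<Rightarrow> f x * g y) has_sum f x * T) B" for x
    using has_sum_cmult_right[OF assms(2), of "f x"] by simp
  show "((\<lambda>x. f x * T) has_sum S * T) A"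
    using has_sum_cmult_left[OF assms(1)] .
  have "(\<lambda>x. norm (f x)) summable_on A" "(\<lambda>x. norm (g x)) summable_on B"
    using has_sum_imp_summable[OF assms(1)] has_sum_imp_summable[OF assms(2)]
    by (simp_all only: summable_on_iff_abs_summable_on_complex)
  hence "(\<lambda>x. norm (case x of (x, y) \<Rightarrow> f x * g y)) summable_on A \<times> B"
    by (intro Infinite_Sum.abs_summable_on_Sigma_iff[THEN iffD2] conjI ballI)
      (auto simp: norm_mult infsum_cmult_right' abs_mult infsum_nonneg intro!: summable_on_cmult_right summable_on_cmult_left)
  thus "(\<lambda>(x, y). f x * g y) summable_on A \<times> B"
    by (rule Infinite_Sum.abs_summable_summable)
qed

lemma holomorphic_imp_has_sum:
  assumes "f holomorphic_on ball 0 1" "norm w < 1"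
  shows   "((\<lambda>n. (deriv ^^ n) f 0 / fact n * w ^ n) has_sum f w) UNIV"
proof -
  define a where "a = (\<lambda>n. (deriv ^^ n) f 0 / fact n)"
  have s: "(\<lambda>n. a n * u ^ n) sums f u" if "norm u < 1" for u
    using holomorphic_power_series[OF assms(1), of u] that by (simp add: a_def)
  obtain t where t: "norm w < t" "t < 1" using assms(2) dense by blast
  have "0 < t" using t(1) norm_ge_zero[of w] by linarith
  have "summable (\<lambda>n. norm (a n * w ^ n))"
    by (rule powser_insidea[of _ "of_real t"]) (use s[of "of_real t"] t \<open>0 < t\<close> in \<open>auto simp: sums_iff\<close>)
  from norm_summable_imp_has_sum[OF this s[OF assms(2)]] show ?thesis
    unfolding a_def .
qed

text \<open>
  Up to a constant and a power of \<open>\<zeta>\<^bsup>1/2\<^esup>\<close>, the product formula reads \<open>\<phi>(z) = A(\<zeta>) A(q/\<zeta>)\<close> for one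
  function \<open>A\<close>. In the strip both \<open>\<zeta>\<close> and \<open>q/\<zeta>\<close> lie in the unit disc, where \<open>A\<close> is holomorphic, so \<open>\<phi>\<close> is a
  product of two absolutely convergent power series, one in \<open>\<zeta>\<close> and one in \<open>\<zeta>\<^bsup>-1\<^esup>\<close>. The sum over a
  fibre of the exponent does not involve \<open>z\<close>, so it serves as the coefficient for all \<open>z\<close> at once.
\<close>
lemma is_fourier_coeffs_exists:
  assumes "Im \<tau> > 0"
  shows   "\<exists>c. is_fourier_coeffs M N \<tau> c"
proof -
  define A where "A = (\<lambda>w. qpoch_inf (-w) \<tau> ^ M / qpoch_inf w \<tau> ^ N)"
  define a where "a = (\<lambda>n. (deriv ^^ n) A 0 / fact n)"
  define q where "q = cexp2pi \<tau>"
  define p where "p = - \<i> * cexp2pi (\<tau> / 8) * qpoch_inf q \<tau>"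
  \<comment> \<open>The factor \<open>cexp2pi (-1/4)\<close> is what the shift by \<open>1/2\<close> makes of \<open>\<zeta>\<^bsup>-1/2\<^esup>\<close>.\<close>
  define C where "C = (p * cexp2pi (- (1/4))) ^ M / p ^ N"
  \<comment> \<open>The monomial is \<open>\<zeta>\<^bsup>(N-M)/2\<^esup>\<close>; its exponent agrees with \<open>(M-N)/2\<close> modulo integers.\<close>
  define r0 :: real where "r0 = (real N - real M) / 2"
  define h :: "nat \<times> nat \<Rightarrow> real" where "h = (\<lambda>(n, m). r0 + real n - real m)"
  define b where "b = (\<lambda>(n, m). a n * (a m * q ^ m))"
  define c where "c = (\<lambda>r. C * (\<Sum>\<^sub>\<infinity>x\<in>{x. h x = r}. b x))"
  have "A holomorphic_on ball 0 1"
    unfolding A_def by (intro holomorphic_intros assms) (auto simp: qpoch_inf_nonzero[OF assms])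
  hence A: "((\<lambda>n. a n * w ^ n) has_sum A w) UNIV" if "norm w < 1" for w
    using holomorphic_imp_has_sum that unfolding a_def by blast
  have "((\<lambda>r. c r * cexp2pi (of_real r * z)) has_sum jphi M N z \<tau>) (fourier_index M N)"
    if z: "0 < Im z" "Im z < Im \<tau>" for z
  proof -
    define \<zeta> where "\<zeta> = cexp2pi z"
    define e where "e = cexp2pi (of_real r0 * z)"
    have \<zeta>: "norm \<zeta> < 1" "norm (inverse \<zeta> * q) < 1"
      using z by (simp_all add: \<zeta>_def q_def norm_cexp2pi_less_1_iff flip: cexp2pi_minus cexp2pi_add)
    have 0: "cexp2pi (of_real (h x) * z) = e * \<zeta> ^ fst x * inverse \<zeta> ^ snd x" for x
      by (cases x) (simp add: h_def e_def \<zeta>_def cexp2pi_power algebra_simps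
                      flip: cexp2pi_add cexp2pi_minus)
    have "((\<lambda>(n, m). (a n * \<zeta> ^ n) * (a m * (inverse \<zeta> * q) ^ m)) has_sum
             A \<zeta> * A (inverse \<zeta> * q)) (UNIV \<times> UNIV)"
      by (intro has_sum_times A \<zeta>)
    hence "((\<lambda>x. C * e * (case x of (n, m) \<Rightarrow> (a n * \<zeta> ^ n) * (a m * (inverse \<zeta> * q) ^ m))) has_sum
             C * e * (A \<zeta> * A (inverse \<zeta> * q))) UNIV"
      by (intro has_sum_cmult_right) simp
    also have "(\<lambda>x. C * e * (case x of (n, m) \<Rightarrow> (a n * \<zeta> ^ n) * (a m * (inverse \<zeta> * q) ^ m))) =
                 (\<lambda>x. C * (b x * cexp2pi (of_real (h x) * z)))"
      by (auto simp: fun_eq_iff b_def 0 power_mult_distrib)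
    also have "C * e * (A \<zeta> * A (inverse \<zeta> * q)) = jphi M N z \<tau>"
    proof -
      define s where "s = cexp2pi (- (z / 2))"
      have 1: "jtheta z \<tau> = p * s * (qpoch_inf \<zeta> \<tau> * qpoch_inf (inverse \<zeta> * q) \<tau>)"
        by (simp add: jtheta_def p_def \<zeta>_def s_def q_def cexp2pi_minus)
      have "cexp2pi (- ((z + 1/2) / 2)) = cexp2pi (- (1/4)) * s"
        unfolding s_def cexp2pi_add[symmetric] by (rule arg_cong[of _ _ cexp2pi]) (simp add: field_simps)
      moreover have "cexp2pi (z + 1/2) = - \<zeta>" "cexp2pi (- (z + 1/2)) = - inverse \<zeta>"
        by (simp_all only: cexp2pi_add_half cexp2pi_minus \<zeta>_def inverse_minus_eq)
      ultimately have 2: "jtheta (z + 1/2) \<tau> =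
          p * cexp2pi (- (1/4)) * s * (qpoch_inf (-\<zeta>) \<tau> * qpoch_inf (-(inverse \<zeta> * q)) \<tau>)"
        by (simp add: jtheta_def p_def q_def)
      have "e = s ^ M / s ^ N"
        by (simp add: s_def e_def cexp2pi_power field_simps r0_def flip: cexp2pi_diff)
      thus ?thesis unfolding jphi_def 1 2
        by (simp add: C_def A_def power_mult_distrib)
    qed
    finally have S: "((\<lambda>x. C * (b x * cexp2pi (of_real (h x) * z))) has_sum jphi M N z \<tau>) UNIV" .
    show ?thesis
    proof (rule has_sum_fibres[OF S])
      have "r0 + real n - real m \<in> fourier_index M N" for n m
        unfolding fourier_index_def r0_def
        by (rule CollectI, rule exI[of _ "int N - int M + int n - int m"]) (auto simp: field_simps)
      thus "range h \<subseteq> fourier_index M N" by (auto simp: h_def)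
    next
      fix r
      have "(\<lambda>x. C * (b x * cexp2pi (of_real (h x) * z))) summable_on {x\<in>UNIV. h x = r}"
        by (rule summable_on_subset_banach[OF has_sum_imp_summable[OF S]]) auto
      also have "?this \<longleftrightarrow> (\<lambda>x. (C * cexp2pi (of_real r * z)) * b x) summable_on {x\<in>UNIV. h x = r}"
        by (intro summable_on_cong) (auto simp: mult_ac)
      finally have *: "(\<lambda>x. (C * cexp2pi (of_real r * z)) * b x) summable_on {x\<in>UNIV. h x = r}" .
      have "((\<lambda>x. (C * cexp2pi (of_real r * z)) * b x) has_sum c r * cexp2pi (of_real r * z)) {x\<in>UNIV. h x = r}"
        using has_sum_infsum[OF *] unfolding infsum_cmult_right' by (simp add: c_def mult_ac)
      thus "((\<lambda>x. C * (b x * cexp2pi (of_real (h x) * z))) has_sum c r * cexp2pi (of_real r * z)) {x\<in>UNIV. h x = r}"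
        by (rule has_sum_cong[THEN iffD1, rotated]) (auto simp: mult_ac)
    qed
  qed
  thus ?thesis unfolding is_fourier_coeffs_def by blast
qed

lemma contour_integral_cexp2pi_line:
  "contour_integral (linepath (Complex (- (1 / 2)) y) (Complex (1 / 2) y)) (\<lambda>z. cexp2pi (of_int k * z)) =
     (if k = 0 then 1 else 0)"
proof (cases "k = 0")
  case True
  thus ?thesis by (simp add: complex_eq_iff)
next
  case False
  define F where "F = (\<lambda>z. cexp2pi (of_int k * z) / (2 * of_real pi * \<i> * of_int k))"
  let ?a = "Complex (- (1 / 2)) y"
  have "((\<lambda>z. cexp2pi (of_int k * z)) has_contour_integral
     F (pathfinish (linepath ?a (Complex (1 / 2) y))) - F (pathstart (linepath ?a (Complex (1 / 2) y))))
     (linepath ?a (Complex (1 / 2) y))"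
  proof (rule contour_integral_primitive[of UNIV])
    fix x
    show "(F has_field_derivative cexp2pi (of_int k * x)) (at x within UNIV)"
      unfolding F_def
      using DERIV_cdivide[OF has_field_derivative_cexp2pi[of "of_int k" x], of "2 * of_real pi * \<i> * of_int k"] False
      by simp
  qed auto
  moreover have "Complex (1 / 2) y = ?a + 1" by (simp add: complex_eq_iff)
  hence "cexp2pi (of_int k * Complex (1 / 2) y) = cexp2pi (of_int k * ?a)"
    by (simp add: ring_distribs cexp2pi_add)
  ultimately show ?thesis using False
    by (simp add: F_def contour_integral_unique)
qed

lemma fourier_index_diff:
  "r \<in> fourier_index M N \<Longrightarrow> s \<in> fourier_index M N \<Longrightarrow> \<exists>k. s - r = of_int k"
proof -
  assume "r \<in> fourier_index M N" "s \<in> fourier_index M N"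
  then obtain k l :: int where "r = (real M - real N) / 2 + of_int k" "s = (real M - real N) / 2 + of_int l"
    unfolding fourier_index_def by blast
  hence "s - r = of_int (l - k)" by simp
  thus ?thesis ..
qed

text \<open>
  On a horizontal line the moduli of the terms are constant, so the Fourier expansion converges
  uniformly there and can be integrated term by term. The identity determines the coefficients
  and connects them with contour integration.
\<close>
lemma fourier_coeff_eq_integral:
  assumes c: "is_fourier_coeffs M N \<tau> c" and r: "r \<in> fourier_index M N"
    and y: "0 < y" "y < Im \<tau>"
  shows "contour_integral (linepath (Complex (- (1 / 2)) y) (Complex (1 / 2) y))
           (\<lambda>z. jphi M N z \<tau> * cexp2pi (- (of_real r * z))) = c r"
proof -
  define I where "I = fourier_index M N"
  define \<gamma> where "\<gamma> = linepath (Complex (- (1 / 2)) y) (Complex (1 / 2) y)"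
  define f where "f = (\<lambda>s z. c s * cexp2pi (of_real s * z) * cexp2pi (- (of_real r * z)))"
  have Im: "Im z = y" if "z \<in> path_image \<gamma>" for z
    using that by (auto simp: \<gamma>_def closed_segment_same_Im)
  have hs: "((\<lambda>s. c s * cexp2pi (of_real s * z)) has_sum jphi M N z \<tau>) I" if "Im z = y" for z
    using c y that unfolding is_fourier_coeffs_def I_def by blast
  have lim: "uniform_limit (path_image \<gamma>) (\<lambda>X z. \<Sum>s\<in>X. f s z)
          (\<lambda>z. jphi M N z \<tau> * cexp2pi (- (of_real r * z))) (finite_subsets_at_top I)"
  proof (rule Weierstrass_m_test_general')
    show "norm (f s z) \<le> norm (f s (Complex 0 y))" if "z \<in> path_image \<gamma>" for s z
      using Im[OF that] by (simp add: f_def norm_mult norm_cexp2pi)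
    show "((\<lambda>s. f s z) has_sum jphi M N z \<tau> * cexp2pi (- (of_real r * z))) I"
      if "z \<in> path_image \<gamma>" for z
      unfolding f_def by (intro has_sum_cmult_left hs Im that)
    have "(\<lambda>s. f s (Complex 0 y)) summable_on I"
      unfolding f_def by (intro summable_on_cmult_left has_sum_imp_summable[OF hs]) auto
    thus "(\<lambda>s. norm (f s (Complex 0 y))) summable_on I"
      by (simp add: summable_on_iff_abs_summable_on_complex)
  qed
  have int: "contour_integral \<gamma> (\<lambda>z. \<Sum>s\<in>X. f s z) = c r" if X: "finite X" "{r} \<subseteq> X" "X \<subseteq> I" for X
  proof -
    have "contour_integral \<gamma> (\<lambda>z. \<Sum>s\<in>X. f s z) = (\<Sum>s\<in>X. contour_integral \<gamma> (f s))"
      unfolding \<gamma>_def f_def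
      by (intro contour_integral_sum X contour_integrable_continuous_linepath continuous_intros)
    also have "\<dots> = (\<Sum>s\<in>X. if s = r then c r else 0)"
    proof (intro sum.cong refl)
      fix s assume "s \<in> X"
      then obtain k where k: "s - r = of_int k"
        using fourier_index_diff[OF r, of s] X by (auto simp: I_def)
      have "f s = (\<lambda>z. c s * cexp2pi (of_int k * z))"
      proof
        fix z
        have "complex_of_real s = of_real r + of_int k"
          using k by (simp add: complex_eq_iff)
        hence "cexp2pi (of_real s * z) * cexp2pi (- (of_real r * z)) = cexp2pi (of_int k * z)"
          unfolding cexp2pi_add[symmetric] by (simp add: ring_distribs)
        thus "f s z = c s * cexp2pi (of_int k * z)" by (simp add: f_def)
      qed
      hence "contour_integral \<gamma> (f s) = c s * (if k = 0 then 1 else 0)"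
        unfolding \<gamma>_def
        by (simp only:) (subst contour_integral_lmul,
              auto intro!: contour_integrable_continuous_linepath continuous_intros
                   simp: contour_integral_cexp2pi_line)
      thus "contour_integral \<gamma> (f s) = (if s = r then c r else 0)" using k by auto
    qed
    also have "\<dots> = c r" using X by (simp add: sum.delta)
    finally show ?thesis .
  qed
  have "((\<lambda>X. contour_integral \<gamma> (\<lambda>z. \<Sum>s\<in>X. f s z)) \<longlongrightarrow>
      contour_integral \<gamma> (\<lambda>z. jphi M N z \<tau> * cexp2pi (- (of_real r * z)))) (finite_subsets_at_top I)"
  proof (rule contour_integral_uniform_limit(2)[OF _ lim])
    show "\<forall>\<^sub>F X in finite_subsets_at_top I. (\<lambda>z. \<Sum>s\<in>X. f s z) contour_integrable_on \<gamma>"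
      unfolding \<gamma>_def f_def
      by (intro always_eventually allI contour_integrable_continuous_linepath continuous_intros)
    show "norm (vector_derivative \<gamma> (at t)) \<le> norm (Complex (1 / 2) y - Complex (- (1 / 2)) y)" for t
      by (simp add: \<gamma>_def)
  qed (auto simp: \<gamma>_def)
  moreover have "((\<lambda>X. contour_integral \<gamma> (\<lambda>z. \<Sum>s\<in>X. f s z)) \<longlongrightarrow> c r) (finite_subsets_at_top I)"
    by (rule tendsto_eventually)
      (use r in \<open>auto simp: eventually_finite_subsets_at_top I_def intro!: exI[of _ "{r}"] int[unfolded I_def]\<close>)
  ultimately show ?thesis
    unfolding \<gamma>_def by (intro tendsto_unique) auto
qed

corollary fourier_coeffs_unique:
  assumes "is_fourier_coeffs M N \<tau> c" "is_fourier_coeffs M N \<tau> c'" "r \<in> fourier_index M N" "Im \<tau> > 0"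
  shows   "c r = c' r"
  using fourier_coeff_eq_integral[OF assms(1,3), of "Im \<tau> / 2"]
        fourier_coeff_eq_integral[OF assms(2,3), of "Im \<tau> / 2"] assms(4) by simp

section \<open>The two symmetries as relations between Fourier coefficients\<close>

lemma fourier_index_uminus: "r \<in> fourier_index (2 * M) (N + 2 * M) \<Longrightarrow> - r \<in> fourier_index (2 * M) (N + 2 * M)"
proof -
  assume "r \<in> fourier_index (2 * M) (N + 2 * M)"
  then obtain k :: int where "r = - real N / 2 + of_int k"
    unfolding fourier_index_def by auto
  hence "- r = (real (2 * M) - real (N + 2 * M)) / 2 + of_int (int N - k)" by simp
  thus ?thesis unfolding fourier_index_def by blast
qed

lemma fourier_index_add_int:
  "r \<in> fourier_index M N \<Longrightarrow> r + of_int l \<in> fourier_index M N"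
proof -
  assume "r \<in> fourier_index M N"
  then obtain k :: int where "r = (real M - real N) / 2 + of_int k"
    unfolding fourier_index_def by auto
  hence "r + of_int l = (real M - real N) / 2 + of_int (k + l)" by simp
  thus ?thesis unfolding fourier_index_def by blast
qed

lemma cexp2pi_fourier_index:
  assumes "r \<in> fourier_index (2 * M) (N + 2 * M)"
  shows   "cexp2pi (of_real r) = (-1) ^ N"
proof -
  obtain k :: int where k: "r = - real N / 2 + of_int k"
    using assms unfolding fourier_index_def by auto
  have "cexp2pi (of_real r) = inverse (cexp2pi (of_nat N * (1/2))) * cexp2pi (of_int k)"
    unfolding cexp2pi_minus[symmetric] cexp2pi_add[symmetric] k
    by simp
  also have "\<dots> = inverse (cexp2pi (1/2) ^ N)"
    unfolding cexp2pi_power by simp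
  also have "\<dots> = (-1) ^ N"
    by (simp add: power_inverse [symmetric])
  finally show ?thesis .
qed

text \<open>
  The map \<open>z \<mapsto> \<tau> - z\<close> preserves the strip, so the Fourier expansion at \<open>\<tau> - z\<close>, multiplied by the
  automorphy factor, is another Fourier expansion of \<open>\<phi>\<close> at \<open>z\<close>; uniqueness gives the relation.
\<close>
lemma fourier_coeff_reflect:
  assumes c: "is_fourier_coeffs (2 * M) (N + 2 * M) \<tau> c"
    and r: "r \<in> fourier_index (2 * M) (N + 2 * M)" and \<tau>: "Im \<tau> > 0"
  shows "c r = cexp2pi (of_real (real N / 2 - r) * \<tau>) * c (real N - r)"
proof -
  define I where "I = fourier_index (2 * M) (N + 2 * M)"
  define c' where "c' = (\<lambda>r. cexp2pi (of_real (real N / 2 - r) * \<tau>) * c (real N - r))"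
  have I: "real N - s \<in> I" if "s \<in> I" for s
    using fourier_index_add_int[OF fourier_index_uminus[of s M N], of "int N"] that by (simp add: I_def)
  have "is_fourier_coeffs (2 * M) (N + 2 * M) \<tau> c'"
    unfolding is_fourier_coeffs_def
  proof (intro allI impI)
    fix z assume z: "0 < Im z \<and> Im z < Im \<tau>"
    hence "((\<lambda>s. c s * cexp2pi (of_real s * (\<tau> - z))) has_sum jphi (2 * M) (N + 2 * M) (\<tau> - z) \<tau>) I"
      using c unfolding is_fourier_coeffs_def I_def by simp
    hence "((\<lambda>s. cexp2pi (- (of_nat N * (\<tau> / 2 - z))) * (c s * cexp2pi (of_real s * (\<tau> - z)))) has_sum
              cexp2pi (- (of_nat N * (\<tau> / 2 - z))) * jphi (2 * M) (N + 2 * M) (\<tau> - z) \<tau>) I"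
      by (rule has_sum_cmult_right)
    also have "cexp2pi (- (of_nat N * (\<tau> / 2 - z))) * jphi (2 * M) (N + 2 * M) (\<tau> - z) \<tau> =
                 jphi (2 * M) (N + 2 * M) z \<tau>"
      by (simp add: jphi_reflect[OF \<tau>] cexp2pi_minus)
    also have "((\<lambda>s. cexp2pi (- (of_nat N * (\<tau> / 2 - z))) * (c s * cexp2pi (of_real s * (\<tau> - z)))) has_sum
        jphi (2 * M) (N + 2 * M) z \<tau>) I \<longleftrightarrow>
        ((\<lambda>r. c' r * cexp2pi (of_real r * z)) has_sum jphi (2 * M) (N + 2 * M) z \<tau>) I"
    proof (rule has_sum_reindex_bij_witness[of _ "\<lambda>s. real N - s" "\<lambda>s. real N - s"])
      fix s
      have "cexp2pi (of_real (real N / 2 - (real N - s)) * \<tau>) * cexp2pi (of_real (real N - s) * z) =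
        cexp2pi (- (of_nat N * (\<tau> / 2 - z))) * cexp2pi (of_real s * (\<tau> - z))"
        unfolding cexp2pi_add[symmetric] by (rule arg_cong[of _ _ cexp2pi]) (simp add: field_simps)
      thus "c' (real N - s) * cexp2pi (of_real (real N - s) * z) =
         cexp2pi (- (of_nat N * (\<tau> / 2 - z))) * (c s * cexp2pi (of_real s * (\<tau> - z)))"
        by (simp add: c'_def)
    qed (use I in auto)
    finally show "((\<lambda>r. c' r * cexp2pi (of_real r * z)) has_sum jphi (2 * M) (N + 2 * M) z \<tau>)
        (fourier_index (2 * M) (N + 2 * M))" by (simp add: I_def)
  qed
  from fourier_coeffs_unique[OF c this r \<tau>] show ?thesis by (simp add: c'_def)
qed

lemma contour_integral_linepath_translate:
  "contour_integral (linepath (a + h) (b + h)) f = contour_integral (linepath a b) (\<lambda>z. f (z + h))"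
proof -
  have "linepath (a + h) (b + h) x = linepath a b x + h" for x
    by (simp add: linepath_def algebra_simps scaleR_conv_of_real)
  thus ?thesis by (simp add: contour_integral_integral)
qed

lemma contour_integral_linepath_uminus:
  "contour_integral (linepath (-a) (-b)) f = - contour_integral (linepath a b) (\<lambda>z. f (-z))"
proof -
  have "linepath (-a) (-b) x = - linepath a b x" for x
    by (simp add: linepath_def algebra_simps)
  moreover have "f (- linepath a b x) * (-b + a) = - (f (- linepath a b x) * (b - a))" for x
    by (simp add: algebra_simps)
  ultimately show ?thesis by (simp add: contour_integral_integral)
qed

lemma contour_integral_linepath_swap:
  "contour_integral (linepath a b) f = - contour_integral (linepath b a) (f :: complex \<Rightarrow> complex)"
  using contour_integral_reversepath[of "linepath b a" f] by simp

text \<open>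
  The difference of the two line integrals is the integral around a rectangle, because by
  periodicity the contributions of its vertical sides cancel.
\<close>
lemma periodic_line_integral_jump:
  assumes hol: "f holomorphic_on {z. \<bar>Im z\<bar> < t \<and> \<bar>Re z\<bar> < 1} - {0}"
    and per: "\<And>z. f (z + 1) = f z" and y: "0 < y" "y < t"
  shows "contour_integral (linepath (Complex (- (1 / 2)) (-y)) (Complex (1 / 2) (-y))) f -
         contour_integral (linepath (Complex (- (1 / 2)) y) (Complex (1 / 2) y)) f =
         2 * of_real pi * \<i> * residue f 0"
proof -
  define S where "S = {z. \<bar>Im z\<bar> < t \<and> \<bar>Re z\<bar> < 1}"
  let ?a1 = "Complex (- (1 / 2)) (-y)" and ?a2 = "Complex (1 / 2) (-y)"
  let ?a3 = "Complex (1 / 2) y" and ?a4 = "Complex (- (1 / 2)) y"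
  have S_eq: "S = box (Complex (-1) (-t)) (Complex 1 t)"
    by (auto simp: S_def in_box_complex_iff)
  have S: "open S" "convex S" by (simp_all add: S_eq open_box convex_box)
  have sub: "cbox ?a1 ?a3 \<subseteq> S"
    using y by (auto simp: in_cbox_complex_iff S_def)
  have pi: "path_image (rectpath ?a1 ?a3) \<subseteq> S - {0}"
    using sub y by (auto simp: path_image_rectpath_cbox_minus_box in_box_complex_iff)
  have w: "winding_number (rectpath ?a1 ?a3) 0 = 1"
    using y by (intro winding_number_rectpath) (auto simp: in_box_complex_iff)
  have "contour_integral (rectpath ?a1 ?a3) f =
          2 * pi * \<i> * (\<Sum>p\<in>{0}. winding_number (rectpath ?a1 ?a3) p * residue f p)"
  proof (rule Residue_theorem[of S])
    show "\<forall>z. z \<notin> S \<longrightarrow> winding_number (rectpath ?a1 ?a3) z = 0"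
      using sub y by (auto intro!: winding_number_rectpath_outside)
  qed (use S hol pi in \<open>auto simp: S_def convex_connected\<close>)
  hence res: "contour_integral (rectpath ?a1 ?a3) f = 2 * of_real pi * \<i> * residue f 0"
    using w by simp
  have cont: "continuous_on (path_image (rectpath ?a1 ?a3)) f"
    using pi hol by (intro holomorphic_on_imp_continuous_on[OF holomorphic_on_subset]) (auto simp: S_def)
  have int: "f contour_integrable_on linepath ?a1 ?a2" "f contour_integrable_on linepath ?a2 ?a3"
    "f contour_integrable_on linepath ?a3 ?a4" "f contour_integrable_on linepath ?a4 ?a1"
    using cont by (auto intro!: contour_integrable_continuous_linepath
        intro: continuous_on_subset simp: rectpath_def Let_def path_image_join)
  have "contour_integral (rectpath ?a1 ?a3) f = contour_integral (linepath ?a1 ?a2) f +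
          contour_integral (linepath ?a2 ?a3) f + contour_integral (linepath ?a3 ?a4) f +
          contour_integral (linepath ?a4 ?a1) f"
    unfolding rectpath_def Let_def using int
    by (simp add: contour_integrable_joinI)
  moreover have "contour_integral (linepath ?a2 ?a3) f = - contour_integral (linepath ?a4 ?a1) f"
  proof -
    have "contour_integral (linepath (?a1 + 1) (?a4 + 1)) f = contour_integral (linepath ?a1 ?a4) f"
      by (simp add: contour_integral_linepath_translate per)
    moreover have "?a1 + 1 = ?a2" "?a4 + 1 = ?a3" by (simp_all add: complex_eq_iff)
    ultimately show ?thesis using contour_integral_linepath_swap[of ?a1 ?a4 f] by simp
  qed
  ultimately show ?thesis
    using res contour_integral_linepath_swap[of ?a3 ?a4 f] by simp
qed

text \<open>
  The coefficients of \<open>\<phi>\<close> below the real line are those above it up to sign and \<open>r \<mapsto> -r\<close>, because \<open>\<phi>\<close> is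
  even or odd. So the residue at \<open>0\<close>, the jump across the real line, is expressed by the
  coefficients in the one strip alone.
\<close>
lemma fourier_coeff_residue:
  assumes c: "is_fourier_coeffs (2 * M) (N + 2 * M) \<tau> c"
    and r: "r \<in> fourier_index (2 * M) (N + 2 * M)" and \<tau>: "Im \<tau> > 0"
  shows "(-1) ^ N * c (-r) - c r =
    2 * of_real pi * \<i> * residue (\<lambda>z. jphi (2 * M) (N + 2 * M) z \<tau> * cexp2pi (- (of_real r * z))) 0"
proof -
  define f where "f = (\<lambda>z. jphi (2 * M) (N + 2 * M) z \<tau> * cexp2pi (- (of_real r * z)))"
  define y where "y = Im \<tau> / 2"
  have y: "0 < y" "y < Im \<tau>" using \<tau> by (simp_all add: y_def)
  have "contour_integral (linepath (Complex (- (1 / 2)) (-y)) (Complex (1 / 2) (-y))) f -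
         contour_integral (linepath (Complex (- (1 / 2)) y) (Complex (1 / 2) y)) f =
         2 * of_real pi * \<i> * residue f 0"
  proof (rule periodic_line_integral_jump[of _ "Im \<tau>"])
    have "z = 0" if "z \<in> \<int>" "\<bar>Re z\<bar> < 1" for z
      using that by (elim Ints_cases) auto
    thus "f holomorphic_on {z. \<bar>Im z\<bar> < Im \<tau> \<and> \<bar>Re z\<bar> < 1} - {0}"
      unfolding f_def by (intro holomorphic_intros holomorphic_jphi \<tau>) auto
    show "f (z + 1) = f z" for z
    proof -
      have "cexp2pi (- (of_real r * (z + 1))) = cexp2pi (- (of_real r * z)) * inverse (cexp2pi (of_real r))"
        unfolding cexp2pi_minus[symmetric] cexp2pi_add[symmetric] by (simp add: algebra_simps)
      thus ?thesis unfolding f_def jphi_plus_1 cexp2pi_fourier_index[OF r]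
        by (simp add: power_inverse [symmetric] power_mult_distrib [symmetric])
    qed
  qed (use y in auto)
  moreover have "contour_integral (linepath (Complex (- (1 / 2)) y) (Complex (1 / 2) y)) f = c r"
    unfolding f_def by (intro fourier_coeff_eq_integral c r y)
  moreover have "contour_integral (linepath (Complex (- (1 / 2)) (-y)) (Complex (1 / 2) (-y))) f = (-1) ^ N * c (-r)"
  proof -
    have "Complex (- (1 / 2)) (-y) = - Complex (1 / 2) y" "Complex (1 / 2) (-y) = - Complex (- (1 / 2)) y"
      by (simp_all add: complex_eq_iff)
    hence "contour_integral (linepath (Complex (- (1 / 2)) (-y)) (Complex (1 / 2) (-y))) f =
            - contour_integral (linepath (Complex (1 / 2) y) (Complex (- (1 / 2)) y)) (\<lambda>z. f (-z))"
      by (simp only: contour_integral_linepath_uminus)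
    also have "\<dots> = contour_integral (linepath (Complex (- (1 / 2)) y) (Complex (1 / 2) y)) (\<lambda>z. f (-z))"
      by (subst contour_integral_linepath_swap) simp
    also have "(\<lambda>z. f (-z)) = (\<lambda>z. (-1) ^ N * (jphi (2 * M) (N + 2 * M) z \<tau> * cexp2pi (- (of_real (-r) * z))))"
      unfolding f_def jphi_minus[OF \<tau>] by (simp add: mult.assoc)
    also have "contour_integral (linepath (Complex (- (1 / 2)) y) (Complex (1 / 2) y)) \<dots> = (-1) ^ N *
       contour_integral (linepath (Complex (- (1 / 2)) y) (Complex (1 / 2) y))
         (\<lambda>z. jphi (2 * M) (N + 2 * M) z \<tau> * cexp2pi (- (of_real (-r) * z)))"
      by (cases "even N") (simp_all add: contour_integral_neg)
    also have "contour_integral (linepath (Complex (- (1 / 2)) y) (Complex (1 / 2) y))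
         (\<lambda>z. jphi (2 * M) (N + 2 * M) z \<tau> * cexp2pi (- (of_real (-r) * z))) = c (-r)"
      by (intro fourier_coeff_eq_integral c fourier_index_uminus r y)
    finally show ?thesis .
  qed
  ultimately show ?thesis by (simp add: f_def)
qed

section \<open>The Laurent expansion at the origin\<close>

text \<open>
  The order of the pole is at most the exponent of the only vanishing factor \<open>1 - \<zeta>\<close>, which has
  a simple zero at \<open>0\<close>.
\<close>
lemma jphi_has_laurent_expansion:
  assumes \<tau>: "Im \<tau> > 0"
  obtains F where "(\<lambda>z. jphi M N z \<tau>) has_laurent_expansion F"
    and "\<And>i. i < - int N \<Longrightarrow> fls_nth F i = 0"
proof -
  have "open {z. \<bar>Im z\<bar> < Im \<tau>}"
    by (intro open_Collect_less continuous_intros)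
  hence "jphi_numerator M N \<tau> analytic_on {0}"
    using holomorphic_jphi_numerator[OF \<tau>, of M N] \<tau> by (intro analytic_at[THEN iffD2] exI) auto
  then obtain G where G: "jphi_numerator M N \<tau> has_fps_expansion G"
    using analytic_at_imp_has_fps_expansion_0 by blast
  define E where "E = (1 - fps_exp (2 * of_real pi * \<i>) :: complex fps)"
  have E: "(\<lambda>z. 1 - cexp2pi z) has_fps_expansion E"
    unfolding E_def cexp2pi_def by (intro fps_expansion_intros)
  have "subdegree E = 1"
    by (rule subdegreeI) (auto simp: E_def)
  define F where "F = fps_to_fls G / fps_to_fls E ^ N"
  have "(\<lambda>z. jphi_numerator M N \<tau> z / (1 - cexp2pi z) ^ N) has_laurent_expansion F"
    unfolding F_def by (intro laurent_expansion_intros has_laurent_expansion_fps G E)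
  hence "(\<lambda>z. jphi M N z \<tau>) has_laurent_expansion F"
    using jphi_eq_numerator[OF \<tau>] by simp
  moreover have "fls_nth F i = 0" if "i < - int N" for i
  proof (cases "F = 0")
    case False
    have "fls_subdegree (fps_to_fls E ^ N) = int N"
      using \<open>subdegree E = 1\<close> by (simp add: fls_subdegree_pow fls_subdegree_fls_to_fps)
    hence "fls_subdegree F \<ge> - int N"
      using fls_divide_subdegree_ge[of "fps_to_fls G" "fps_to_fls E ^ N"] False
        fls_subdegree_fls_to_fps_gt0[of G] by (simp add: F_def)
    with that show ?thesis by (intro fls_eq0_below_subdegree) simp
  qed auto
  ultimately show ?thesis by (rule that)
qed

lemma jlaurent_eq:
  assumes "(\<lambda>z. jphi M N z \<tau>) has_laurent_expansion F"
  shows   "jlaurent M N k \<tau> = (2 * of_real pi * \<i>) ^ k * fls_nth F (- int k)"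
  unfolding jlaurent_def laurent_expansion_0_eqI[OF assms] ..

text \<open>
  In the variable \<open>2\<pi>iz\<close> the exponential has coefficients \<open>(-r)\<^sup>l / l!\<close>, and the residue of a product pairs
  them with the coefficients of the principal part of \<open>\<phi>\<close>. The result is a polynomial in \<open>r\<close>.
\<close>
lemma residue_jphi_exp:
  assumes \<tau>: "Im \<tau> > 0"
  shows "2 * of_real pi * \<i> * residue (\<lambda>z. jphi M N z \<tau> * cexp2pi (- (of_real r * z))) 0 =
    (\<Sum>k=1..N. jlaurent M N k \<tau> * (- of_real r) ^ (k - 1) / fact (k - 1))"
proof -
  obtain F where F: "(\<lambda>z. jphi M N z \<tau>) has_laurent_expansion F"
    and F0: "\<And>i. i < - int N \<Longrightarrow> fls_nth F i = 0"
    using jphi_has_laurent_expansion[OF \<tau>] by blast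
  define w :: complex where "w = 2 * of_real pi * \<i>"
  define E where "E = fps_to_fls (fps_exp (- (w * of_real r)))"
  have "(\<lambda>z. exp (- (w * of_real r) * z)) has_laurent_expansion E"
    unfolding E_def by (intro has_laurent_expansion_fps has_fps_expansion_exp)
  also have "(\<lambda>z. exp (- (w * of_real r) * z)) = (\<lambda>z. cexp2pi (- (of_real r * z)))"
    by (simp add: cexp2pi_def w_def mult_ac)
  finally have E: "(\<lambda>z. cexp2pi (- (of_real r * z))) has_laurent_expansion E" .
  have "residue (\<lambda>z. jphi M N z \<tau> * cexp2pi (- (of_real r * z))) 0 = fls_nth (F * E) (-1)"
    using has_laurent_expansion_residue_0[OF has_laurent_expansion_mult[OF F E]] by simp
  also have "\<dots> = (\<Sum>i=fls_subdegree F..-1. fls_nth F i * fls_nth E (-1 - i))"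
    by (subst fls_times_nth(2)) (simp add: E_def fls_subdegree_fls_to_fps)
  also have "\<dots> = (\<Sum>i=-int N..-1. fls_nth F i * fls_nth E (-1 - i))"
  proof (cases "fls_subdegree F \<ge> - int N")
    case True
    thus ?thesis by (intro sum.mono_neutral_left) auto
  next
    case False
    thus ?thesis using F0 by (intro sum.mono_neutral_right) auto
  qed
  also have "\<dots> = (\<Sum>k=1..N. fls_nth F (- int k) * fls_nth E (-1 + int k))"
    by (rule sum.reindex_bij_witness[of _ "\<lambda>k. - int k" "\<lambda>i. nat (- i)"]) auto
  also have "w * \<dots> = (\<Sum>k=1..N. jlaurent M N k \<tau> * (- of_real r) ^ (k - 1) / fact (k - 1))"
    unfolding sum_distrib_left
  proof (rule sum.cong)
    fix k assume k: "k \<in> {1..N}"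
    then obtain l where l: "k = Suc l" by (cases k) auto
    have "fls_nth E (-1 + int k) = (- (w * of_real r)) ^ l / fact l"
      by (simp add: E_def l)
    also have "\<dots> = w ^ l * (- of_real r) ^ l / fact l"
      by (simp flip: power_mult_distrib)
    finally show "w * (fls_nth F (- int k) * fls_nth E (-1 + int k)) =
       jlaurent M N k \<tau> * (- of_real r) ^ (k - 1) / fact (k - 1)"
      by (simp add: jlaurent_eq[OF F] l w_def)
  qed auto
  finally show ?thesis by (simp add: w_def)
qed

text \<open>
  Substituting \<open>-X\<close> multiplies the \<open>k\<close>-th coefficient by \<open>(-1)\<^sup>k\<close>.
\<close>
lemma fls_nth_parity:
  fixes f :: "complex \<Rightarrow> complex"
  assumes F: "f has_laurent_expansion F" and f: "\<And>z. f (-z) = (-1) ^ N * f z"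
    and "odd (k + int N)"
  shows   "fls_nth F k = 0"
proof -
  define d where "d = fls_subdegree F"
  have "(f \<circ> (\<lambda>z. -z)) has_laurent_expansion fls_compose_fps F (-fps_X)"
    by (intro has_laurent_expansion_compose F has_laurent_expansion_fps fps_expansion_intros) auto
  hence "(\<lambda>z. (-1) ^ N * f z) has_laurent_expansion fls_compose_fps F (-fps_X)"
    by (simp add: o_def f)
  moreover have "(\<lambda>z. (-1) ^ N * f z) has_laurent_expansion fls_const ((-1) ^ N) * F"
    by (intro laurent_expansion_intros F)
  ultimately have eq: "fls_compose_fps F (-fps_X) = fls_const ((-1) ^ N) * F"
    by (rule has_laurent_expansion_unique)
  define B where "B = fls_base_factor_to_fps F"
  have B: "F = fls_shift (-d) (fps_to_fls B)"
    unfolding B_def d_def by (rule fls_conv_base_factor_to_fps_shift_subdegree)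
  have "fls_compose_fps F (-fps_X) = fps_to_fls (B oo -fps_X) * (-fls_X) powi d"
    unfolding fls_compose_fps_def B_def d_def by simp
  also have "(-fls_X :: complex fls) powi d = fls_const ((-1) powi d) * fls_X_intpow d"
    by (simp add: power_int_minus_left)
  also have "fps_to_fls (B oo -fps_X) * (fls_const ((-1) powi d) * fls_X_intpow d) =
     fls_const ((-1) powi d) * fls_shift (-d) (fps_to_fls (B oo -fps_X))"
    by (subst mult.left_commute) (simp only: fls_X_intpow_times_conv_shift)
  finally have "fls_nth (fls_compose_fps F (-fps_X)) k =
      (-1) powi d * fls_nth (fps_to_fls (B oo -fps_X)) (k - d)"
    by simp
  also have "\<dots> = (-1) powi d * ((-1) powi (k - d) * fls_nth (fps_to_fls B) (k - d))"
    by (auto simp: fps_compose_uminus' power_int_def)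
  also have "\<dots> = (-1) powi k * fls_nth F k"
    by (subst B) (simp flip: power_int_add mult.assoc)
  finally have "fls_nth (fls_compose_fps F (-fps_X)) k = (-1) powi k * fls_nth F k" .
  moreover have "fls_nth (fls_compose_fps F (-fps_X)) k = (-1) ^ N * fls_nth F k"
    unfolding eq by (simp flip: fls_const_power)
  ultimately have "(-1) powi k * fls_nth F k = (-1) ^ N * fls_nth F k" by (simp only:)
  with assms(3) show ?thesis by (auto simp: power_int_minus_left uminus_power_if split: if_splits)
qed

lemma jlaurent_parity:
  assumes "Im \<tau> > 0" "odd (k + N)"
  shows   "jlaurent (2 * M) (N + 2 * M) k \<tau> = 0"
proof -
  obtain F where F: "(\<lambda>z. jphi (2 * M) (N + 2 * M) z \<tau>) has_laurent_expansion F"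
    using jphi_has_laurent_expansion[OF assms(1)] by blast
  show ?thesis
    using fls_nth_parity[OF F jphi_minus[OF assms(1)], of "- int k"] assms(2)
    by (simp add: jlaurent_eq[OF F])
qed

section \<open>Termwise derivatives of theta-like series\<close>

text \<open>
  The operator \<open>q d/dq\<close> multiplies \<open>q\<^sup>b\<close> by \<open>b\<close>. Since the summability hypothesis holds for every \<open>t > 0\<close>, each
  differentiated series converges uniformly on half-planes \<open>Im \<tau> > t\<close>, which justifies
  differentiating term by term.
\<close>
lemma Dq_iterate:
  fixes a :: "nat \<Rightarrow> complex" and b :: "nat \<Rightarrow> real"
  assumes b: "\<And>n. b n \<ge> 0"
    and summ: "\<And>j t. t > 0 \<Longrightarrow> summable (\<lambda>n. norm (a n) * b n ^ j * exp (- 2 * pi * b n * t))"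
    and "Im \<tau> > 0"
  shows "(\<lambda>n. a n * of_real (b n) ^ j * cexp2pi (of_real (b n) * \<tau>)) sums
           (Dq ^^ j) (\<lambda>\<tau>. \<Sum>n. a n * cexp2pi (of_real (b n) * \<tau>)) \<tau>"
proof -
  define H where "H = {\<tau>. Im \<tau> > 0}"
  have H: "open H" unfolding H_def by (intro open_Collect_less continuous_intros)
  define u where "u = (\<lambda>j n \<tau>. a n * of_real (b n) ^ j * cexp2pi (of_real (b n) * \<tau>))"
  have bound: "norm (u j n z) \<le> norm (a n) * b n ^ j * exp (- 2 * pi * b n * t)"
    if "Im z \<ge> t" for j n z t
  proof -
    have "b n * t \<le> b n * Im z" using b that by (intro mult_left_mono)
    thus ?thesis using b[of n]
      by (auto simp: u_def norm_mult norm_power norm_cexp2pi mult.assoc intro!: mult_left_mono)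
  qed
  have S: "summable (\<lambda>n. u j n z)" if "z \<in> H" for j z
    by (rule summable_comparison_test'[OF summ[of "Im z" j] bound]) (use that in \<open>auto simp: H_def\<close>)
  have D: "((\<lambda>z. \<Sum>n. u j n z) has_field_derivative (2 * of_real pi * \<i>) * (\<Sum>n. u (Suc j) n z)) (at z)"
    if z: "z \<in> H" for j z
  proof -
    \<comment> \<open>Any height strictly between \<open>0\<close> and \<open>Im z\<close> gives a half-plane around \<open>z\<close> with a uniform bound.\<close>
    define t where "t = Im z / 2"
    define T where "T = {z. Im z > t}"
    have t: "t > 0" "z \<in> T" "T \<subseteq> H" using z by (auto simp: t_def T_def H_def)
    have T: "open T" "convex T"
      unfolding T_def using convex_halfspace_Im_gt by (auto intro!: open_Collect_less continuous_intros)
    have "((\<lambda>z. \<Sum>n. u j n z) has_field_derivative (\<Sum>n. 2 * of_real pi * \<i> * u (Suc j) n z)) (at z)"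
    proof (rule has_field_derivative_series'(2))
      show "convex T" by fact
      show "(u j n has_field_derivative 2 * of_real pi * \<i> * u (Suc j) n x) (at x within T)" for n x
        unfolding u_def
        by (rule has_field_derivative_at_within)
          (use DERIV_cmult[OF has_field_derivative_cexp2pi[of "of_real (b n)" x], of "a n * of_real (b n) ^ j"] in
            \<open>simp add: mult_ac\<close>)
      have "uniformly_convergent_on T (\<lambda>n x. \<Sum>i<n. u (Suc j) i x)"
        by (rule Weierstrass_m_test'[OF bound summ[OF t(1)]]) (auto simp: T_def)
      thus "uniformly_convergent_on T (\<lambda>n x. \<Sum>i<n. 2 * of_real pi * \<i> * u (Suc j) i x)"
        unfolding sum_distrib_left[symmetric]
        by (rule uniformly_convergent_mult)
      show "z \<in> T" "z \<in> interior T" using t T by (auto simp: interior_open)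
      show "summable (\<lambda>n. u j n z)" using S z by blast
    qed
    thus ?thesis by (simp add: suminf_mult S z)
  qed
  have "(Dq ^^ j) (\<lambda>\<tau>. \<Sum>n. u 0 n \<tau>) z = (\<Sum>n. u j n z)" if "z \<in> H" for z
    using that
  proof (induction j arbitrary: z)
    case (Suc j)
    have "eventually (\<lambda>x. (Dq ^^ j) (\<lambda>\<tau>. \<Sum>n. u 0 n \<tau>) x = (\<Sum>n. u j n x)) (nhds z)"
      using eventually_nhds_in_open[OF H Suc.prems] by eventually_elim (rule Suc.IH)
    hence "deriv ((Dq ^^ j) (\<lambda>\<tau>. \<Sum>n. u 0 n \<tau>)) z = deriv (\<lambda>x. \<Sum>n. u j n x) z"
      by (rule deriv_cong_ev) auto
    also have "\<dots> = (2 * of_real pi * \<i>) * (\<Sum>n. u (Suc j) n z)"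
      by (rule DERIV_imp_deriv[OF D[OF Suc.prems]])
    finally show ?case by (simp add: Dq_def[of "(Dq ^^ j) _"])
  qed auto
  moreover have "\<tau> \<in> H" using assms by (simp add: H_def)
  ultimately have "(\<lambda>n. u j n \<tau>) sums (Dq ^^ j) (\<lambda>\<tau>. \<Sum>n. u 0 n \<tau>) \<tau>"
    using summable_sums[OF S[of \<tau> j]] by simp
  thus ?thesis by (simp add: u_def)
qed

lemma summable_gaussian:
  fixes s c :: real and p :: nat
  assumes "c > 0"
  shows "summable (\<lambda>n. \<bar>real n + s\<bar> ^ p * exp (- c * (real n + s)\<^sup>2))"
proof (rule summable_comparison_test_bigo)
  show "summable (\<lambda>n. norm (1 / real n ^ 2))"
    using inverse_power_summable[of 2, where 'a = real] by (simp add: divide_inverse)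
  have *: "(\<lambda>n. (real n + s) powr real p * exp (- c * (real n + s)\<^sup>2)) \<in> O(\<lambda>n. 1 / real n ^ 2)"
    using assms by real_asymp
  \<comment> \<open>Once \<open>n + s\<close> is positive, the power of its absolute value is the real power \<open>powr\<close>.\<close>
  have "eventually (\<lambda>n. real n + s > 0) sequentially" by real_asymp
  hence "eventually (\<lambda>n. (real n + s) powr real p * exp (- c * (real n + s)\<^sup>2) =
           \<bar>real n + s\<bar> ^ p * exp (- c * (real n + s)\<^sup>2)) sequentially"
    by eventually_elim (simp add: powr_realpow)
  from landau_o.big.in_cong[OF this] * show "(\<lambda>n. \<bar>real n + s\<bar> ^ p * exp (- c * (real n + s)\<^sup>2)) \<in> O(\<lambda>n. 1 / real n ^ 2)"
    by (simp only:)
qed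

section \<open>Summation of the recurrence\<close>

text \<open>
  For the indices \<open>2M\<close> and \<open>N + 2M\<close>, the jump \<open>(-1)\<^sup>N c(-s) - c(s)\<close> of the Fourier coefficients across the real line, a polynomial in \<open>s\<close>.
\<close>
definition residue_polynomial :: "nat \<Rightarrow> nat \<Rightarrow> complex \<Rightarrow> real \<Rightarrow> complex" where
  "residue_polynomial M N \<tau> s = (\<Sum>k=1..N. jlaurent M N k \<tau> * (- of_real s) ^ (k - 1) / fact (k - 1))"

lemma fourier_coeff_recurrence:
  assumes c: "is_fourier_coeffs (2 * M) (N + 2 * M) \<tau> c"
    and s: "s \<in> fourier_index (2 * M) (N + 2 * M)" and \<tau>: "Im \<tau> > 0"
  shows "c s = (-1) ^ N * cexp2pi (of_real (real N / 2 + s) * \<tau>) * c (s + real N) -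
               residue_polynomial (2 * M) (N + 2 * M) \<tau> s"
proof -
  have "(-1) ^ N * c (-s) - c s = residue_polynomial (2 * M) (N + 2 * M) \<tau> s"
    unfolding fourier_coeff_residue[OF c s \<tau>] residue_polynomial_def by (rule residue_jphi_exp[OF \<tau>])
  moreover have "c (-s) = cexp2pi (of_real (real N / 2 + s) * \<tau>) * c (s + real N)"
    using fourier_coeff_reflect[OF c fourier_index_uminus[OF s] \<tau>] by (simp add: add.commute)
  ultimately show ?thesis by (simp add: algebra_simps)
qed

text \<open>
  The exponents collected on the way are \<open>N/2 + r + iN\<close> for \<open>i < m\<close>, whose sum is \<open>mr + Nm\<^sup>2/2\<close>.
\<close>
lemma fourier_coeff_iterate:
  fixes r :: real
  assumes c: "is_fourier_coeffs (2 * M) (N + 2 * M) \<tau> c"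
    and r: "r \<in> fourier_index (2 * M) (N + 2 * M)" and \<tau>: "Im \<tau> > 0"
  defines "u \<equiv> (\<lambda>n. (-1) ^ (N * n) * cexp2pi (of_real (real n * r + real N / 2 * real n ^ 2) * \<tau>))"
  shows "c r = u m * c (r + real m * real N) - (\<Sum>n<m. u n * residue_polynomial (2 * M) (N + 2 * M) \<tau> (r + real n * real N))"
proof (induction m)
  case (Suc m)
  have "u (Suc m) = u m * ((-1) ^ N * cexp2pi (of_real (real N / 2 + (r + real m * real N)) * \<tau>))"
  proof -
    have "cexp2pi (of_real (real (Suc m) * r + real N / 2 * real (Suc m) ^ 2) * \<tau>) =
            cexp2pi (of_real (real m * r + real N / 2 * real m ^ 2) * \<tau>) *
            cexp2pi (of_real (real N / 2 + (r + real m * real N)) * \<tau>)"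
      unfolding cexp2pi_add[symmetric] by (rule arg_cong[of _ _ cexp2pi]) (simp add: field_simps power2_eq_square)
    thus ?thesis by (simp add: u_def power_add mult_ac del: of_nat_Suc)
  qed
  moreover have "r + real m * real N \<in> fourier_index (2 * M) (N + 2 * M)"
    using fourier_index_add_int[OF r, of "int m * int N"] by simp
  note fourier_coeff_recurrence[OF c this \<tau>]
  moreover have "r + real m * real N + real N = r + real (Suc m) * real N" by (simp add: algebra_simps)
  ultimately show ?case
    using Suc.IH by (simp add: ring_distribs mult.assoc)
qed (simp add: u_def)

text \<open>
  The terms of a convergent expansion are bounded; here it is evaluated at the middle of the
  strip. Exponential growth in \<open>s\<close> is good enough, as it is compared with a Gaussian.
\<close>
lemma fourier_coeff_bound:
  assumes c: "is_fourier_coeffs M N \<tau> c" and \<tau>: "Im \<tau> > 0"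
  obtains B where "\<And>s. s \<in> fourier_index M N \<Longrightarrow> norm (c s) \<le> B * exp (pi * Im \<tau> * s)"
proof -
  define z where "z = Complex 0 (Im \<tau> / 2)"
  define f where "f = (\<lambda>s. c s * cexp2pi (of_real s * z))"
  have "0 < Im z" "Im z < Im \<tau>" using \<tau> by (simp_all add: z_def)
  hence "(f has_sum jphi M N z \<tau>) (fourier_index M N)"
    using c unfolding is_fourier_coeffs_def f_def by blast
  hence "f summable_on fourier_index M N" by (rule has_sum_imp_summable)
  hence f: "(\<lambda>s. norm (f s)) summable_on fourier_index M N"
    by (simp add: summable_on_iff_abs_summable_on_complex)
  show ?thesis
  proof (rule that)
    fix s assume "s \<in> fourier_index M N"
    hence "(\<Sum>x\<in>{s}. norm (f x)) \<le> (\<Sum>\<^sub>\<infinity>x\<in>fourier_index M N. norm (f x))"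
      by (intro finite_sum_le_infsum f) auto
    hence "norm (c s) * exp (- (pi * Im \<tau> * s)) \<le> (\<Sum>\<^sub>\<infinity>x\<in>fourier_index M N. norm (f x))"
      by (simp add: f_def norm_mult norm_cexp2pi z_def mult_ac)
    thus "norm (c s) \<le> (\<Sum>\<^sub>\<infinity>x\<in>fourier_index M N. norm (f x)) * exp (pi * Im \<tau> * s)"
      by (simp add: exp_minus field_simps)
  qed
qed

text \<open>
  The limit of the iterated recurrence: the remainder is a Gaussian in \<open>m\<close> times an exponential.
\<close>
lemma fourier_coeff_sums:
  fixes r :: real
  assumes c: "is_fourier_coeffs (2 * M) (N + 2 * M) \<tau> c"
    and r: "r \<in> fourier_index (2 * M) (N + 2 * M)" and \<tau>: "Im \<tau> > 0" and N: "N \<ge> 1"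
  shows "(\<lambda>n. (-1) ^ (N * n) * cexp2pi (of_real (real n * r + real N / 2 * real n ^ 2) * \<tau>) *
           residue_polynomial (2 * M) (N + 2 * M) \<tau> (r + real n * real N)) sums (- c r)"
proof -
  define u where "u = (\<lambda>n. (-1) ^ (N * n) * cexp2pi (of_real (real n * r + real N / 2 * real n ^ 2) * \<tau>))"
  define t where "t = Im \<tau>"
  obtain B where B: "\<And>s. s \<in> fourier_index (2 * M) (N + 2 * M) \<Longrightarrow> norm (c s) \<le> B * exp (pi * Im \<tau> * s)"
    using fourier_coeff_bound[OF c \<tau>] by blast
  have "(\<lambda>m. u m * c (r + real m * real N)) \<longlonglongrightarrow> 0"
  proof (rule Lim_null_comparison)
    define x where "x = real N"
    have "x > 0" "t > 0" using N \<tau> by (simp_all add: x_def t_def)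
    hence "(\<lambda>m. exp (- 2 * pi * t * (real m * r + x / 2 * (real m)^2) + pi * t * (r + real m * x))) \<longlonglongrightarrow> 0"
      by real_asymp
    from tendsto_mult_right_zero[OF this, of B]
    show "(\<lambda>m. B * exp (- 2 * pi * t * (real m * r + real N / 2 * (real m)^2) + pi * t * (r + real m * real N))) \<longlonglongrightarrow> 0"
      by (simp only: x_def)
    show "\<forall>\<^sub>F m in sequentially. norm (u m * c (r + real m * real N)) \<le>
      B * exp (- 2 * pi * t * (real m * r + real N / 2 * (real m)^2) + pi * t * (r + real m * real N))"
    proof (intro always_eventually allI)
      fix m
      have "r + real m * real N \<in> fourier_index (2 * M) (N + 2 * M)"
        using fourier_index_add_int[OF r, of "int m * int N"] by simp
      from B[OF this] have "norm (u m) * norm (c (r + real m * real N)) \<le>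
          norm (u m) * (B * exp (pi * t * (r + real m * real N)))"
        unfolding t_def by (intro mult_left_mono) auto
      also have "norm (u m) * (B * exp (pi * t * (r + real m * real N))) =
          exp (- 2 * pi * t * (real m * r + real N / 2 * (real m)^2)) * (B * exp (pi * t * (r + real m * real N)))"
        by (simp add: u_def norm_mult norm_power norm_cexp2pi t_def mult_ac)
      finally show "norm (u m * c (r + real m * real N)) \<le>
         B * exp (- 2 * pi * t * (real m * r + real N / 2 * (real m)^2) + pi * t * (r + real m * real N))"
        by (simp only: exp_add norm_mult mult_ac)
    qed
  qed
  hence "(\<lambda>m. u m * c (r + real m * real N) - c r) \<longlonglongrightarrow> 0 - c r"
    by (intro tendsto_intros)
  moreover have "u m * c (r + real m * real N) - c r =
      (\<Sum>n<m. u n * residue_polynomial (2 * M) (N + 2 * M) \<tau> (r + real n * real N))" for m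
    using fourier_coeff_iterate[OF c r \<tau>, of m] by (simp add: u_def)
  ultimately show ?thesis by (simp add: sums_def u_def)
qed

text \<open>
  Laurent coefficients of index \<open>k\<close> not congruent to \<open>N\<close> modulo \<open>2\<close> vanish because \<open>\<phi>(-z) = (-1)\<^sup>N \<phi>(z)\<close>; the
  remaining indices are \<open>k = 2j + \<delta> + 1\<close>, and the largest of them is \<open>N + 2M\<close>, the bound for the pole order.
\<close>
lemma residue_polynomial_parity:
  assumes \<tau>: "Im \<tau> > 0" and N: "N \<ge> 1"
  shows "residue_polynomial (2 * M) (N + 2 * M) \<tau> s =
    (\<Sum>j=0..(N - 1 - delta_e N) div 2 + M. jlaurent (2 * M) (N + 2 * M) (2 * j + delta_e N + 1) \<tau> *
       (- of_real s) ^ (2 * j + delta_e N) / fact (2 * j + delta_e N))"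
proof -
  let ?g = "\<lambda>k. jlaurent (2 * M) (N + 2 * M) k \<tau> * (- of_real s) ^ (k - 1) / fact (k - 1)"
  have "residue_polynomial (2 * M) (N + 2 * M) \<tau> s = (\<Sum>k\<in>{k\<in>{1..N+2*M}. even (k + N)}. ?g k)"
    unfolding residue_polynomial_def by (intro sum.mono_neutral_right) (auto simp: jlaurent_parity[OF \<tau>])
  also have "\<dots> = (\<Sum>j=0..(N - 1 - delta_e N) div 2 + M. ?g (2 * j + delta_e N + 1))"
  proof (rule sum.reindex_bij_witness[of _ "\<lambda>j. 2 * j + delta_e N + 1" "\<lambda>k. (k - 1 - delta_e N) div 2"])
    fix k assume k: "k \<in> {k\<in>{1..N+2*M}. even (k + N)}"
    have *: "2 * ((k - 1 - delta_e N) div 2) + delta_e N + 1 = k"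
    proof (cases "even N")
      case True
      hence "even k" using k by auto
      thus ?thesis using k True by (auto simp: delta_e_def elim!: evenE)
    next
      case False
      hence "odd k" using k by auto
      thus ?thesis using False by (auto simp: delta_e_def elim!: oddE)
    qed
    show "2 * ((k - 1 - delta_e N) div 2) + delta_e N + 1 = k" by fact
    show "?g (2 * ((k - 1 - delta_e N) div 2) + delta_e N + 1) = ?g k" by (simp only: *)
    show "(k - 1 - delta_e N) div 2 \<in> {0..(N - 1 - delta_e N) div 2 + M}"
    proof -
      have "(k - 1 - delta_e N) div 2 \<le> (N - 1 - delta_e N + 2 * M) div 2"
        using k N by (intro div_le_mono) (auto simp: delta_e_def)
      thus ?thesis by simp
    qed
  next
    fix j assume j: "j \<in> {0..(N - 1 - delta_e N) div 2 + M}"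
    show "(2 * j + delta_e N + 1 - 1 - delta_e N) div 2 = j" by simp
    have "2 * ((N - 1 - delta_e N) div 2) + delta_e N + 1 = N"
      using N by (auto simp: delta_e_def elim!: evenE oddE)
    moreover have "even (2 * j + delta_e N + 1 + N)" by (simp add: delta_e_def)
    ultimately show "2 * j + delta_e N + 1 \<in> {k\<in>{1..N+2*M}. even (k + N)}"
      using j by simp
  qed
  finally show ?thesis by simp
qed

lemma Dq_partial_theta_sums:
  fixes r :: real
  assumes N: "N \<ge> 1" and \<tau>: "Im \<tau> > 0"
  shows "(\<lambda>n. (-1) ^ (N * n) * of_real ((real n + r / real N) ^ delta_e N) *
            of_real (real N / 2 * (real n + r / real N)\<^sup>2) ^ j *
            cexp2pi (of_real (real N / 2 * (real n + r / real N)\<^sup>2) * \<tau>))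
         sums (Dq ^^ j) (partial_theta N r) \<tau>"
proof -
  define a :: "nat \<Rightarrow> complex" where "a = (\<lambda>n. (-1) ^ (N * n) * of_real ((real n + r / real N) ^ delta_e N))"
  define b where "b = (\<lambda>n. real N / 2 * (real n + r / real N)\<^sup>2)"
  have "partial_theta N r = (\<lambda>\<tau>. \<Sum>n. a n * cexp2pi (of_real (b n) * \<tau>))"
    by (simp add: partial_theta_def a_def b_def fun_eq_iff)
  moreover have "(\<lambda>n. a n * of_real (b n) ^ j * cexp2pi (of_real (b n) * \<tau>)) sums
           (Dq ^^ j) (\<lambda>\<tau>. \<Sum>n. a n * cexp2pi (of_real (b n) * \<tau>)) \<tau>"
  proof (rule Dq_iterate[OF _ _ \<tau>])
    show "b n \<ge> 0" for n by (simp add: b_def)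
  next
    fix j and t :: real assume t: "t > 0"
    have "summable (\<lambda>n. (real N / 2) ^ j * (\<bar>real n + r / real N\<bar> ^ (delta_e N + 2 * j) *
             exp (- (pi * real N * t) * (real n + r / real N)\<^sup>2)))"
      using t N by (intro summable_mult summable_gaussian) auto
    also have "(\<lambda>n. (real N / 2) ^ j * (\<bar>real n + r / real N\<bar> ^ (delta_e N + 2 * j) *
             exp (- (pi * real N * t) * (real n + r / real N)\<^sup>2))) =
         (\<lambda>n. norm (a n) * b n ^ j * exp (- 2 * pi * b n * t))"
    proof
      fix n
      define X where "X = real n + r / real N"
      have "norm (a n) = \<bar>X\<bar> ^ delta_e N"
        by (simp add: a_def X_def norm_mult norm_power power_abs del: of_real_power of_real_add)
      moreover have "b n ^ j = (real N / 2) ^ j * \<bar>X\<bar> ^ (2 * j)"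
        by (simp add: b_def X_def power_mult flip: power_mult_distrib)
      moreover have "- 2 * pi * b n * t = - (pi * real N * t) * X\<^sup>2"
        by (simp add: b_def X_def)
      ultimately show "(real N / 2) ^ j * (\<bar>real n + r / real N\<bar> ^ (delta_e N + 2 * j) *
             exp (- (pi * real N * t) * (real n + r / real N)\<^sup>2)) =
          norm (a n) * b n ^ j * exp (- 2 * pi * b n * t)"
        unfolding X_def[symmetric] by (simp only: power_add mult_ac)
    qed
    finally show "summable (\<lambda>n. norm (a n) * b n ^ j * exp (- 2 * pi * b n * t))" .
  qed
  ultimately show ?thesis by (simp add: a_def b_def)
qed

text \<open>
  Completing the square in \<open>nr + Nn\<^sup>2/2\<close> turns the series for \<open>c r\<close> into a combination of the series for the
  \<open>q d/dq\<close>-derivatives of the partial theta function, term by term in \<open>n\<close>.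
\<close>
lemma fourier_coeff_formula:
  fixes r :: real
  assumes c: "is_fourier_coeffs (2 * M) (N + 2 * M) \<tau> c"
    and r: "r \<in> fourier_index (2 * M) (N + 2 * M)" and \<tau>: "Im \<tau> > 0" and N: "N \<ge> 1"
  shows "c r = (-1) ^ (1 + delta_e N) * cexp2pi (of_real (- (r\<^sup>2) / (2 * real N)) * \<tau>) *
    (\<Sum>j = 0..(N - 1 - delta_e N) div 2 + M.
       jlaurent (2 * M) (N + 2 * M) (2 * j + delta_e N + 1) \<tau> / fact (2 * j + delta_e N) *
       of_nat N ^ (j + delta_e N) * 2 ^ j * (Dq ^^ j) (partial_theta N r) \<tau>)"
proof -
  let ?J = "{0..(N - 1 - delta_e N) div 2 + M}"
  define D where "D = (\<lambda>j. jlaurent (2 * M) (N + 2 * M) (2 * j + delta_e N + 1) \<tau> / fact (2 * j + delta_e N))"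
  define e where "e = cexp2pi (of_real (- (r\<^sup>2) / (2 * real N)) * \<tau>)"
  define x where "x = (\<lambda>n. real n + r / real N)"
  define g where "g = (\<lambda>n. cexp2pi (of_real (real N / 2 * (x n)\<^sup>2) * \<tau>))"
  define v where "v = (\<lambda>j n. (-1) ^ (N * n) * of_real (x n ^ delta_e N) *
            of_real (real N / 2 * (x n)\<^sup>2) ^ j * g n)"
  have "(\<lambda>n. (-1) ^ (1 + delta_e N) * e * (\<Sum>j\<in>?J. D j * of_nat N ^ (j + delta_e N) * 2 ^ j * v j n)) sums
        ((-1) ^ (1 + delta_e N) * e * (\<Sum>j\<in>?J. D j * of_nat N ^ (j + delta_e N) * 2 ^ j * (Dq ^^ j) (partial_theta N r) \<tau>))"
    unfolding v_def g_def x_def by (intro sums_mult sums_sum Dq_partial_theta_sums N \<tau>)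
  moreover have "(-1) ^ (1 + delta_e N) * e * (\<Sum>j\<in>?J. D j * of_nat N ^ (j + delta_e N) * 2 ^ j * v j n) =
     - ((-1) ^ (N * n) * cexp2pi (of_real (real n * r + real N / 2 * real n ^ 2) * \<tau>) *
           residue_polynomial (2 * M) (N + 2 * M) \<tau> (r + real n * real N))" for n
  proof -
    have q: "cexp2pi (of_real (real n * r + real N / 2 * real n ^ 2) * \<tau>) = e * g n"
      unfolding e_def g_def cexp2pi_add[symmetric] ring_distribs(2)[symmetric] of_real_add[symmetric]
      by (rule arg_cong[of _ _ "\<lambda>y. cexp2pi (of_real y * \<tau>)"])
        (use N in \<open>simp add: x_def field_simps power2_eq_square\<close>)
    have rn: "r + real n * real N = real N * x n" using N by (simp add: x_def field_simps)
    have "of_nat N ^ (j + delta_e N) * 2 ^ j * v j n =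
       (-1) ^ delta_e N * (-1) ^ (N * n) * g n * (- of_real (r + real n * real N)) ^ (2 * j + delta_e N)" for j
    proof -
      have "(2::complex) ^ j * of_real (real N / 2 * (x n)\<^sup>2) ^ j = of_nat N ^ j * of_real (x n) ^ (2 * j)"
        by (simp add: power_mult_distrib [symmetric] power_mult)
      hence "of_nat N ^ (j + delta_e N) * 2 ^ j * v j n = (-1) ^ (N * n) * g n *
          (of_nat N ^ (2 * j + delta_e N) * of_real (x n) ^ (2 * j + delta_e N))"
      proof -
        assume *: "(2::complex) ^ j * of_real (real N / 2 * (x n)\<^sup>2) ^ j = of_nat N ^ j * of_real (x n) ^ (2 * j)"
        have "of_nat N ^ (j + delta_e N) * 2 ^ j * v j n = (-1) ^ (N * n) * g n *
            (of_nat N ^ (j + delta_e N) * of_real (x n) ^ delta_e N *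
              (2 ^ j * of_real (real N / 2 * (x n)\<^sup>2) ^ j))"
          unfolding v_def of_real_power by (simp only: mult_ac)
        thus ?thesis unfolding * by (simp only: power_add mult_2 mult_2_right mult_ac)
      qed
      also have "of_nat N ^ (2 * j + delta_e N) * of_real (x n) ^ (2 * j + delta_e N) =
          (-1) ^ delta_e N * (- of_real (real N * x n) :: complex) ^ (2 * j + delta_e N)"
        by (simp add: power_minus[of "of_nat N * _"] power_mult_distrib power_add power_mult)
      finally show ?thesis by (simp add: rn)
    qed
    hence "(\<Sum>j\<in>?J. D j * of_nat N ^ (j + delta_e N) * 2 ^ j * v j n) =
      (\<Sum>j\<in>?J. (-1) ^ delta_e N * (-1) ^ (N * n) * g n *
        (D j * (- of_real (r + real n * real N)) ^ (2 * j + delta_e N)))"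
      by (intro sum.cong) (simp_all add: mult.assoc mult.left_commute)
    also have "\<dots> = (-1) ^ delta_e N * (-1) ^ (N * n) * g n * residue_polynomial (2 * M) (N + 2 * M) \<tau> (r + real n * real N)"
      unfolding residue_polynomial_parity[OF \<tau> N] sum_distrib_left by (simp add: D_def)
    finally show ?thesis unfolding q by (simp add: mult_ac)
  qed
  moreover note sums_minus[OF fourier_coeff_sums[OF c r \<tau> N]]
  ultimately show ?thesis
    unfolding D_def e_def by (simp add: sums_iff)
qed

text \<open>
  For \<open>r < N/2\<close> the formula is applied to \<open>N - r\<close>; the factor \<open>q\<^bsup>N/2-r\<^esup>\<close> of the reflection converts
  \<open>q\<^bsup>-(N-r)\<^sup>2/2N\<^esup>\<close> into \<open>q\<^bsup>-r\<^sup>2/2N\<^esup>\<close>.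
\<close>
theorem theorem1p4:
  fixes N M :: nat and r :: real and \<tau> :: complex
  assumes "N \<ge> 1"
    and "r \<in> {real N / 2 + of_int k | k. True}"
    and "Im \<tau> > 0"
  shows "jchi (2 * M) (N + 2 * M) r \<tau> =
    (-1) ^ (1 + delta_e N) * cexp2pi (of_real (- (r\<^sup>2) / (2 * real N)) * \<tau>) *
    (\<Sum>j = 0..(N - 1 - delta_e N) div 2 + M.
       jlaurent (2 * M) (N + 2 * M) (2 * j + delta_e N + 1) \<tau> / fact (2 * j + delta_e N) *
       of_nat N ^ (j + delta_e N) * 2 ^ j *
       (Dq ^^ j) (partial_theta N (rho N r)) \<tau>)"
proof -
  define c where "c = (SOME c. is_fourier_coeffs (2 * M) (N + 2 * M) \<tau> c)"
  have c: "is_fourier_coeffs (2 * M) (N + 2 * M) \<tau> c"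
    unfolding c_def by (rule someI_ex[OF is_fourier_coeffs_exists[OF assms(3)]])
  have r: "r \<in> fourier_index (2 * M) (N + 2 * M)"
  proof -
    obtain k :: int where "r = real N / 2 + of_int k" using assms(2) by blast
    hence "r = (real (2 * M) - real (N + 2 * M)) / 2 + of_int (k + int N)" by simp
    thus ?thesis unfolding fourier_index_def by blast
  qed
  show ?thesis
  proof (cases "r \<ge> real N / 2")
    case True
    thus ?thesis using fourier_coeff_formula[OF c r assms(3,1)]
      by (simp add: jchi_def c_def rho_def)
  next
    case False
    have r': "real N - r \<in> fourier_index (2 * M) (N + 2 * M)"
      using fourier_index_add_int[OF fourier_index_uminus[OF r], of "int N"] by simp
    have "cexp2pi (of_real (real N / 2 - r) * \<tau>) * cexp2pi (of_real (- ((real N - r)\<^sup>2) / (2 * real N)) * \<tau>) =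
            cexp2pi (of_real (- (r\<^sup>2) / (2 * real N)) * \<tau>)"
      unfolding cexp2pi_add[symmetric] ring_distribs(2)[symmetric] of_real_add[symmetric]
      by (rule arg_cong[of _ _ "\<lambda>y. cexp2pi (of_real y * \<tau>)"])
        (use assms(1) in \<open>simp add: field_simps power2_eq_square\<close>)
    moreover have "A * (s * B * S) = s * (A * B) * S" for A s B S :: complex
      by (simp only: mult_ac)
    moreover have "jchi (2 * M) (N + 2 * M) r \<tau> = c r" by (simp add: jchi_def c_def)
    moreover have "rho N r = real N - r" using False by (simp add: rho_def)
    ultimately show ?thesis
      using fourier_coeff_reflect[OF c r assms(3)] fourier_coeff_formula[OF c r' assms(3,1)]
      by (simp only:)
  qed
qed

end
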